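(* Let $(A,d)$ be a differential graded commutative algebra with unit over a field $\mathbb{K}$ of characteristic $0$, let $\boldsymbol{i}\colon A\to A$ be a quasi-BV operator of even degree $-2k$, let $\boldsymbol{l}=[\boldsymbol{i},d]$, and assume that $[\boldsymbol{l},\boldsymbol{i}]$ is also a quasi-BV operator on $A$. Let $[\,,\,]_{\boldsymbol{l}}$ be the bracket of degree $-2k+1$ on $A$ defined by \[[a,b]_{\boldsymbol{l}}=(-1)^{\bar a}\big(\boldsymbol{l}(ab)-\boldsymbol{l}(a)b\big)-a\boldsymbol{l}(b).\] Then $(A,d,\cdot,[\,,\,]_{\boldsymbol{l}})$ is a Gerstenhaber algebra whose underlying DGLA $(A[2k-1],d,[\,,\,]_{\boldsymbol{l}})$ is homotopy abelian. If moreover $\boldsymbol{l}^2=0$, then $(A,d,\cdot,[\,,\,]_{\boldsymbol{l}},\boldsymbol{l})$ is a Batalin–Vilkovisky algebra.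
   Context: $[\,,\,]$ on linear endomorphisms of $A$ is the graded commutator; $\bar a$ denotes degree; $A[2k-1]^i=A^{i+2k-1}$. A homogeneous linear map $f\colon A\to A$ is a quasi-BV operator if $f(1)=0$ and $f$ is a differential operator of order $\le 2$, i.e. $[[[f,a],b],c]=0$ for all $a,b,c\in A$ (elements acting by left multiplication); equivalently, $\Phi(a,b)=f(ab)-f(a)b-(-1)^{\bar a\bar f}af(b)$ satisfies $\Phi(a,bc)=\Phi(a,b)c+(-1)^{(\bar a+\bar f)\bar b}b\Phi(a,c)$. Here a Gerstenhaber algebra structure means that $[\,,\,]_{\boldsymbol l}$ makes $(A[2k-1],d)$ a differential graded Lie algebra and satisfies the Poisson (Leibniz) identity with respect to the product of $A$. A DGLA is homotopy abelian if it is quasi-isomorphic to a DGLA with zero bracket. A Batalin–Vilkovisky algebra is a graded commutative algebra with a quasi-BV operator $\Delta$ of odd degree with $\Delta^2=0$ (here together with the differential $d$). *)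

theory Defs
  imports Main HOL.Vector_Spaces "HOL-Library.Function_Algebras"
begin

definition sgnp :: "int \<Rightarrow> 'w::ab_group_add \<Rightarrow> 'w" where
  "sgnp n x = (if even n then x else - x)"

definition gcomm :: "int \<Rightarrow> ('w::ab_group_add \<Rightarrow> 'w) \<Rightarrow> int \<Rightarrow> ('w \<Rightarrow> 'w) \<Rightarrow> ('w \<Rightarrow> 'w)" where
  "gcomm df f dg g = (\<lambda>x. f (g x) - sgnp (df * dg) (g (f x)))"

definition lmul :: "'v::ring_1 \<Rightarrow> 'v \<Rightarrow> 'v" where
  "lmul a = (\<lambda>x. a * x)"

text \<open>A Z-graded vector space inside a K-vector space type: a family of subspaces G n
  whose sum is direct; its carrier is the (direct) sum of the G n.\<close>

definition subsp :: "('k::field \<Rightarrow> 'w::ab_group_add \<Rightarrow> 'w) \<Rightarrow> 'w set \<Rightarrow> bool" where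
  "subsp sc S \<longleftrightarrow> 0 \<in> S \<and> (\<forall>x\<in>S. \<forall>y\<in>S. x + y \<in> S) \<and> (\<forall>c. \<forall>x\<in>S. sc c x \<in> S)"

definition gcarrier :: "(int \<Rightarrow> 'w::ab_group_add set) \<Rightarrow> 'w set" where
  "gcarrier G = {x. \<exists>c. finite {n. c n \<noteq> 0} \<and> (\<forall>n. c n \<in> G n) \<and> x = (\<Sum>n\<in>{n. c n \<noteq> 0}. c n)}"

definition graded_space :: "('k::field \<Rightarrow> 'w::ab_group_add \<Rightarrow> 'w) \<Rightarrow> (int \<Rightarrow> 'w set) \<Rightarrow> bool" where
  "graded_space sc G \<longleftrightarrow> vector_space sc \<and> (\<forall>n. subsp sc (G n)) \<and>
     (\<forall>c. finite {n. c n \<noteq> 0} \<longrightarrow> (\<forall>n. c n \<in> G n) \<longrightarrow>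
          (\<Sum>n\<in>{n. c n \<noteq> 0}. c n) = 0 \<longrightarrow> (\<forall>n. c n = 0))"

definition gcomp :: "(int \<Rightarrow> 'w::ab_group_add set) \<Rightarrow> int \<Rightarrow> 'w \<Rightarrow> 'w" where
  "gcomp G n x = (THE c. finite {n. c n \<noteq> 0} \<and> (\<forall>n. c n \<in> G n) \<and> x = (\<Sum>n\<in>{n. c n \<noteq> 0}. c n)) n"

definition shift :: "(int \<Rightarrow> 'w set) \<Rightarrow> int \<Rightarrow> (int \<Rightarrow> 'w set)" where
  "shift G s = (\<lambda>n. G (n + s))"

definition hom_map :: "('k::field \<Rightarrow> 'a::ab_group_add \<Rightarrow> 'a) \<Rightarrow> (int \<Rightarrow> 'a set) \<Rightarrow>
    ('k \<Rightarrow> 'b::ab_group_add \<Rightarrow> 'b) \<Rightarrow> (int \<Rightarrow> 'b set) \<Rightarrow> int \<Rightarrow> ('a \<Rightarrow> 'b) \<Rightarrow> bool" where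
  "hom_map sa G sb H p f \<longleftrightarrow>
     (\<forall>n x. x \<in> G n \<longrightarrow> f x \<in> H (n + p)) \<and>
     (\<forall>x\<in>gcarrier G. \<forall>y\<in>gcarrier G. f (x + y) = f x + f y) \<and>
     (\<forall>c. \<forall>x\<in>gcarrier G. f (sa c x) = sb c (f x))"

definition lin_on :: "('k::field \<Rightarrow> 'a::ab_group_add \<Rightarrow> 'a) \<Rightarrow> (int \<Rightarrow> 'a set) \<Rightarrow>
    ('k \<Rightarrow> 'b::ab_group_add \<Rightarrow> 'b) \<Rightarrow> ('a \<Rightarrow> 'b) \<Rightarrow> bool" where
  "lin_on sa G sb f \<longleftrightarrow>
     (\<forall>x\<in>gcarrier G. \<forall>y\<in>gcarrier G. f (x + y) = f x + f y) \<and>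
     (\<forall>c. \<forall>x\<in>gcarrier G. f (sa c x) = sb c (f x))"

definition dgca :: "('k::field \<Rightarrow> 'v::ring_1 \<Rightarrow> 'v) \<Rightarrow> (int \<Rightarrow> 'v set) \<Rightarrow> ('v \<Rightarrow> 'v) \<Rightarrow> bool" where
  "dgca sc G d \<longleftrightarrow> graded_space sc G \<and> gcarrier G = UNIV \<and>
     (\<forall>c x y. sc c (x * y) = sc c x * y \<and> sc c (x * y) = x * sc c y) \<and>
     1 \<in> G 0 \<and>
     (\<forall>m n x y. x \<in> G m \<longrightarrow> y \<in> G n \<longrightarrow> x * y \<in> G (m + n)) \<and>
     (\<forall>m n x y. x \<in> G m \<longrightarrow> y \<in> G n \<longrightarrow> x * y = sgnp (m * n) (y * x)) \<and>
     hom_map sc G sc G 1 d \<and> (\<forall>x. d (d x) = 0) \<and>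
     (\<forall>m x y. x \<in> G m \<longrightarrow> d (x * y) = d x * y + sgnp m (x * d y))"

text \<open>Quasi-BV operator of degree p: homogeneous linear, f 1 = 0, differential operator
  of order at most 2: [[[f,a],b],c] = 0 for all (homogeneous) a, b, c.\<close>
definition quasi_BV :: "('k::field \<Rightarrow> 'v::ring_1 \<Rightarrow> 'v) \<Rightarrow> (int \<Rightarrow> 'v set) \<Rightarrow> int \<Rightarrow> ('v \<Rightarrow> 'v) \<Rightarrow> bool" where
  "quasi_BV sc G p f \<longleftrightarrow> hom_map sc G sc G p f \<and> f 1 = 0 \<and>
     (\<forall>na nb nc a b c. a \<in> G na \<longrightarrow> b \<in> G nb \<longrightarrow> c \<in> G nc \<longrightarrow>
        gcomm (p + na + nb) (gcomm (p + na) (gcomm p f na (lmul a)) nb (lmul b)) nc (lmul c)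
          = (\<lambda>_. 0))"

text \<open>The bracket [a,b]_l = (-1)^|a| (l(ab) - l(a) b) - a l(b), for homogeneous a,
  extended linearly in a via the homogeneous components.\<close>
definition brl :: "(int \<Rightarrow> 'v::ring_1 set) \<Rightarrow> ('v \<Rightarrow> 'v) \<Rightarrow> 'v \<Rightarrow> 'v \<Rightarrow> 'v" where
  "brl G l a b = (\<Sum>n\<in>{n. gcomp G n a \<noteq> 0}.
        sgnp n (l (gcomp G n a * b) - l (gcomp G n a) * b)) - a * l b"

definition dgla :: "('k::field \<Rightarrow> 'w::ab_group_add \<Rightarrow> 'w) \<Rightarrow> (int \<Rightarrow> 'w set) \<Rightarrow>
    ('w \<Rightarrow> 'w \<Rightarrow> 'w) \<Rightarrow> ('w \<Rightarrow> 'w) \<Rightarrow> bool" where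
  "dgla sc L br d \<longleftrightarrow> graded_space sc L \<and>
     (\<forall>y\<in>gcarrier L. lin_on sc L sc (\<lambda>x. br x y)) \<and>
     (\<forall>x\<in>gcarrier L. lin_on sc L sc (\<lambda>y. br x y)) \<and>
     (\<forall>m n x y. x \<in> L m \<longrightarrow> y \<in> L n \<longrightarrow> br x y \<in> L (m + n)) \<and>
     (\<forall>m n x y. x \<in> L m \<longrightarrow> y \<in> L n \<longrightarrow> br x y = - sgnp (m * n) (br y x)) \<and>
     (\<forall>m n x y z. x \<in> L m \<longrightarrow> y \<in> L n \<longrightarrow> z \<in> gcarrier L \<longrightarrow>
        br x (br y z) = br (br x y) z + sgnp (m * n) (br y (br x z))) \<and>
     hom_map sc L sc L 1 d \<and> (\<forall>x\<in>gcarrier L. d (d x) = 0) \<and>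
     (\<forall>m x y. x \<in> L m \<longrightarrow> y \<in> gcarrier L \<longrightarrow> d (br x y) = br (d x) y + sgnp m (br x (d y)))"

definition dgla_morphism :: "('k::field \<Rightarrow> 'a::ab_group_add \<Rightarrow> 'a) \<Rightarrow> (int \<Rightarrow> 'a set) \<Rightarrow>
    ('a \<Rightarrow> 'a \<Rightarrow> 'a) \<Rightarrow> ('a \<Rightarrow> 'a) \<Rightarrow>
    ('k \<Rightarrow> 'b::ab_group_add \<Rightarrow> 'b) \<Rightarrow> (int \<Rightarrow> 'b set) \<Rightarrow> ('b \<Rightarrow> 'b \<Rightarrow> 'b) \<Rightarrow> ('b \<Rightarrow> 'b) \<Rightarrow>
    ('a \<Rightarrow> 'b) \<Rightarrow> bool" where
  "dgla_morphism sa L brL dL sb M brM dM f \<longleftrightarrow>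
     dgla sa L brL dL \<and> dgla sb M brM dM \<and> hom_map sa L sb M 0 f \<and>
     (\<forall>x\<in>gcarrier L. f (dL x) = dM (f x)) \<and>
     (\<forall>x\<in>gcarrier L. \<forall>y\<in>gcarrier L. f (brL x y) = brM (f x) (f y))"

text \<open>Quasi-isomorphism: a morphism inducing a bijection H^n(L) -> H^n(M) for every n.\<close>
definition dgla_qiso :: "('k::field \<Rightarrow> 'a::ab_group_add \<Rightarrow> 'a) \<Rightarrow> (int \<Rightarrow> 'a set) \<Rightarrow>
    ('a \<Rightarrow> 'a \<Rightarrow> 'a) \<Rightarrow> ('a \<Rightarrow> 'a) \<Rightarrow>
    ('k \<Rightarrow> 'b::ab_group_add \<Rightarrow> 'b) \<Rightarrow> (int \<Rightarrow> 'b set) \<Rightarrow> ('b \<Rightarrow> 'b \<Rightarrow> 'b) \<Rightarrow> ('b \<Rightarrow> 'b) \<Rightarrow>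
    ('a \<Rightarrow> 'b) \<Rightarrow> bool" where
  "dgla_qiso sa L brL dL sb M brM dM f \<longleftrightarrow>
     dgla_morphism sa L brL dL sb M brM dM f \<and>
     (\<forall>n x. x \<in> L n \<longrightarrow> dL x = 0 \<longrightarrow> f x \<in> dM ` M (n - 1) \<longrightarrow> x \<in> dL ` L (n - 1)) \<and>
     (\<forall>n y. y \<in> M n \<longrightarrow> dM y = 0 \<longrightarrow>
        (\<exists>x\<in>L n. dL x = 0 \<and> y - f x \<in> dM ` M (n - 1)))"

text \<open>Pointwise scalar multiplication on the universe type nat => 'w, in which the
  intermediate DGLAs of zigzags live.\<close>
definition sc_fun :: "('k \<Rightarrow> 'w \<Rightarrow> 'w) \<Rightarrow> 'k \<Rightarrow> (nat \<Rightarrow> 'w) \<Rightarrow> (nat \<Rightarrow> 'w)" where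
  "sc_fun sc c f = (\<lambda>i. sc c (f i))"

definition qi_step :: "('k::field \<Rightarrow> 'u::ab_group_add \<Rightarrow> 'u) \<Rightarrow>
    (int \<Rightarrow> 'u set) \<times> ('u \<Rightarrow> 'u \<Rightarrow> 'u) \<times> ('u \<Rightarrow> 'u) \<Rightarrow>
    (int \<Rightarrow> 'u set) \<times> ('u \<Rightarrow> 'u \<Rightarrow> 'u) \<times> ('u \<Rightarrow> 'u) \<Rightarrow> bool" where
  "qi_step sc X Y \<longleftrightarrow> (case X of (L, brL, dL) \<Rightarrow> case Y of (M, brM, dM) \<Rightarrow>
     (\<exists>f. dgla_qiso sc L brL dL sc M brM dM f) \<or> (\<exists>f. dgla_qiso sc M brM dM sc L brL dL f))"

text \<open>Homotopy abelian: connected by a finite zigzag of DGLA quasi-isomorphisms to a DGLA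
  with zero bracket (intermediate DGLAs taken in the universe nat => 'w).\<close>
definition homotopy_abelian :: "('k::field \<Rightarrow> 'w::ab_group_add \<Rightarrow> 'w) \<Rightarrow> (int \<Rightarrow> 'w set) \<Rightarrow>
    ('w \<Rightarrow> 'w \<Rightarrow> 'w) \<Rightarrow> ('w \<Rightarrow> 'w) \<Rightarrow> bool" where
  "homotopy_abelian sc L br d \<longleftrightarrow> dgla sc L br d \<and>
     (\<exists>M brM dM H dH.
        (\<exists>f. dgla_qiso sc L br d (sc_fun sc) M brM dM f) \<and>
        dgla (sc_fun sc) H (\<lambda>_ _. 0) dH \<and>
        (qi_step (sc_fun sc))\<^sup>*\<^sup>* (M, brM, dM) (H, (\<lambda>_ _. 0), dH))"

definition gerstenhaber :: "('k::field \<Rightarrow> 'v::ring_1 \<Rightarrow> 'v) \<Rightarrow> (int \<Rightarrow> 'v set) \<Rightarrow> ('v \<Rightarrow> 'v) \<Rightarrow>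
    ('v \<Rightarrow> 'v \<Rightarrow> 'v) \<Rightarrow> int \<Rightarrow> bool" where
  "gerstenhaber sc G d br k \<longleftrightarrow> dgca sc G d \<and> dgla sc (shift G (2 * k - 1)) br d \<and>
     (\<forall>na nb a b c. a \<in> G na \<longrightarrow> b \<in> G nb \<longrightarrow>
        br a (b * c) = br a b * c + sgnp ((na - 2 * k + 1) * nb) (b * br a c))"

definition BV_algebra :: "('k::field \<Rightarrow> 'v::ring_1 \<Rightarrow> 'v) \<Rightarrow> (int \<Rightarrow> 'v set) \<Rightarrow> ('v \<Rightarrow> 'v) \<Rightarrow>
    int \<Rightarrow> ('v \<Rightarrow> 'v) \<Rightarrow> bool" where
  "BV_algebra sc G d p \<Delta> \<longleftrightarrow> dgca sc G d \<and> odd p \<and> quasi_BV sc G p \<Delta> \<and>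
     (\<forall>x. \<Delta> (\<Delta> x) = 0) \<and> gcomm 1 d p \<Delta> = (\<lambda>_. 0)"

end

theory Submission
  imports Defs
begin

text \<open>Let \<open>q(a,b)\<close> be, up to sign, the second-order symbol \<open>\<Phi>\<^sub>i(a,b)\<close> of \<open>i\<close>. Since \<open>d\<close> is a
  derivation, \<open>l = [i,d]\<close> gives \<open>[,] = [q,d]\<close>: the bracket is the boundary of \<open>q\<close>. That \<open>[l,i]\<close> has
  order at most two says that the commutator of the symbols of \<open>l\<close> and \<open>i\<close> vanishes, i.e.
  \<open>[q,[,]] = 0\<close>, and \<open>[l,l] = [[l,i],d]\<close> yields the Jacobi identity in the same way. Hence
  \<open>exp(tq)\<close> conjugates \<open>d\<close> into \<open>d + t[,]\<close>. This flat family of structures is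
  a genuine DGLA on \<open>A[t,dt]\<close>, with differential \<open>d + dt \<partial>\<^sub>t\<close> and bracket \<open>t[,] - dt q\<close>, and evaluation
  at \<open>t = 1\<close> and \<open>t = 0\<close> gives quasi-isomorphisms to \<open>(A,d,[,])\<close> and to \<open>(A,d,0)\<close>.\<close>

section \<open>Graded vector spaces\<close>

text \<open>\<open>exp(tq)\<close> is only an L-infinity isomorphism, whereas
  \<open>homotopy_abelian\<close> asks for strict DGLA morphisms; passing to polynomial forms
  replaces the flow by strict maps. The price is a \<open>dt\<close> component in each axiom, and
  the two facts about \<open>q\<close> pay exactly for it. In the Leibniz rule, differentiating the
  factor \<open>t\<close> produces \<open>dt [a,b]\<close>, which is cancelled because the bracket
  is a boundary. In the Jacobi identity the commutator of \<open>q\<close> with the bracket remains,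
  while \<open>[q,q]\<close> cannot appear because \<open>dt\<close> squares to zero. Characteristic
  zero enters twice: integrating \<open>dt t^n\<close> divides by \<open>n + 1\<close>, and the
  Jacobi identity is obtained in the form \<open>T = - T\<close>. The signs follow one pattern:
  symbols of operators are graded symmetric on \<open>A\<close>, and the factor (-1)^|a| together
  with the odd shift \<open>2 * k - 1\<close> makes them graded antisymmetric.\<close>

lemma sgnp_0 [simp]: "sgnp n 0 = 0"
  by (simp add: sgnp_def)

lemma sgnp_add: "sgnp n (x + y) = sgnp n x + sgnp n y"
  by (simp add: sgnp_def)

lemma sum_support:
  fixes c :: "'i \<Rightarrow> 'w::comm_monoid_add"
  assumes "finite S" "{n. c n \<noteq> 0} \<subseteq> S"
  shows "(\<Sum>n\<in>{n. c n \<noteq> 0}. c n) = sum c S"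
  using assms by (intro sum.mono_neutral_left) auto

lemma subsp_sum:
  assumes "subsp sc S" "\<And>x. x \<in> T \<Longrightarrow> f x \<in> S"
  shows "sum f T \<in> S"
  using assms by (induction T rule: infinite_finite_induct) (auto simp: subsp_def)

text \<open>The sign (-1)^deg as one linear involution, so that sign-twisted formulas make sense for
  inhomogeneous elements and remain visibly bilinear.\<close>

definition grading_inv :: "(int \<Rightarrow> 'w::ab_group_add set) \<Rightarrow> 'w \<Rightarrow> 'w" where
  "grading_inv G x = (\<Sum>n\<in>{n. gcomp G n x \<noteq> 0}. sgnp n (gcomp G n x))"

text \<open>With \<open>total\<close>, the linearity conditions in \<open>hom_map\<close> and
  \<open>dgla\<close>, which are relative to the carrier, become unconditional.\<close>

locale total_graded_space =
  fixes sc :: "'k::field \<Rightarrow> 'w::ab_group_add \<Rightarrow> 'w" and G :: "int \<Rightarrow> 'w set"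
  assumes graded: "graded_space sc G" and total: "gcarrier G = UNIV"
begin

sublocale vector_space sc
  using graded by (simp add: graded_space_def)

lemma subsp_G: "subsp sc (G n)"
  using graded by (simp add: graded_space_def)

lemma G_0 [simp]: "0 \<in> G n"
  and G_add: "x \<in> G n \<Longrightarrow> y \<in> G n \<Longrightarrow> x + y \<in> G n"
  and G_scale: "x \<in> G n \<Longrightarrow> sc c x \<in> G n"
  using subsp_G by (auto simp: subsp_def)

lemma G_uminus: "x \<in> G n \<Longrightarrow> - x \<in> G n"
  using G_scale[of x n "-1"] by simp

lemma G_diff: "x \<in> G n \<Longrightarrow> y \<in> G n \<Longrightarrow> x - y \<in> G n"
  using G_add[of x n "- y"] G_uminus by simp

lemma G_sgnp: "x \<in> G n \<Longrightarrow> sgnp m x \<in> G n"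
  by (simp add: sgnp_def G_uminus)

lemmas G_closed = G_add G_scale G_uminus G_diff G_sgnp

definition decomp :: "(int \<Rightarrow> 'w) \<Rightarrow> 'w \<Rightarrow> bool" where
  "decomp c x \<longleftrightarrow> finite {n. c n \<noteq> 0} \<and> (\<forall>n. c n \<in> G n) \<and> x = (\<Sum>n\<in>{n. c n \<noteq> 0}. c n)"

lemma decomp_I:
  assumes "finite S" "{n. c n \<noteq> 0} \<subseteq> S" "\<And>n. c n \<in> G n" "x = sum c S"
  shows "decomp c x"
  using assms sum_support[OF assms(1,2)] finite_subset[OF assms(2,1)] by (simp add: decomp_def)

lemma decomp_add:
  assumes "decomp c x" "decomp c' y"
  shows "decomp (\<lambda>n. c n + c' n) (x + y)"
proof (rule decomp_I)
  let ?S = "{n. c n \<noteq> 0} \<union> {n. c' n \<noteq> 0}"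
  show "finite ?S" using assms by (simp add: decomp_def)
  then show "x + y = (\<Sum>n\<in>?S. c n + c' n)"
    using assms sum_support[of ?S c] sum_support[of ?S c'] by (simp add: decomp_def sum.distrib)
qed (use assms in \<open>auto simp: decomp_def G_add\<close>)

lemma decomp_scale:
  assumes "decomp c x"
  shows "decomp (\<lambda>n. sc a (c n)) (sc a x)"
  by (rule decomp_I[of "{n. c n \<noteq> 0}"])
    (use assms in \<open>auto simp: decomp_def G_scale scale_sum_right\<close>)

lemma decomp_zero_unique:
  assumes "decomp c 0"
  shows "c n = 0"
  using assms graded unfolding decomp_def graded_space_def by metis

lemma decomp_unique:
  assumes "decomp c x" "decomp c' x"
  shows "c = c'"
proof
  fix n
  have "decomp (\<lambda>n. c n + sc (-1) (c' n)) (x + sc (-1) x)"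
    by (intro decomp_add decomp_scale assms)
  then have "decomp (\<lambda>n. c n - c' n) 0" by simp
  then have "c n - c' n = 0" by (rule decomp_zero_unique)
  then show "c n = c' n" by simp
qed

lemma decomp_gcomp: "decomp (\<lambda>n. gcomp G n x) x"
proof -
  obtain c where c: "decomp c x"
    using total unfolding gcarrier_def decomp_def by blast
  then have "(THE c. decomp c x) = c"
    using decomp_unique by blast
  then have "(\<lambda>n. gcomp G n x) = c"
    unfolding gcomp_def decomp_def[symmetric] by simp
  then show ?thesis using c by simp
qed

lemma gcomp_eqI: "decomp c x \<Longrightarrow> gcomp G n x = c n"
  using decomp_unique[OF decomp_gcomp] by metis

lemma gcomp_in: "gcomp G n x \<in> G n"
  and finite_gcomp: "finite {n. gcomp G n x \<noteq> 0}"
  and sum_gcomp: "(\<Sum>n\<in>{n. gcomp G n x \<noteq> 0}. gcomp G n x) = x"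
  using decomp_gcomp[of x] by (auto simp: decomp_def)

lemma gcomp_add: "gcomp G n (x + y) = gcomp G n x + gcomp G n y"
  by (rule gcomp_eqI) (intro decomp_add decomp_gcomp)

lemma gcomp_scale: "gcomp G n (sc c x) = sc c (gcomp G n x)"
  by (rule gcomp_eqI) (intro decomp_scale decomp_gcomp)

lemma gcomp_homogeneous: "x \<in> G m \<Longrightarrow> gcomp G n x = (if n = m then x else 0)"
  by (rule gcomp_eqI, rule decomp_I[of "{m}"]) auto

lemma homogeneous_induct:
  assumes "P 0" "\<And>x y. P x \<Longrightarrow> P y \<Longrightarrow> P (x + y)" "\<And>n x. x \<in> G n \<Longrightarrow> P x"
  shows "P x"
proof -
  have "P (sum (\<lambda>n. gcomp G n x) S)" for S
    by (induction S rule: infinite_finite_induct) (auto intro: assms gcomp_in)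
  then show ?thesis using sum_gcomp[of x] by metis
qed

lemma grading_inv_superset:
  assumes "finite S" "{n. gcomp G n x \<noteq> 0} \<subseteq> S"
  shows "grading_inv G x = (\<Sum>n\<in>S. sgnp n (gcomp G n x))"
  unfolding grading_inv_def using assms by (intro sum.mono_neutral_left) auto

lemma grading_inv_add: "grading_inv G (x + y) = grading_inv G x + grading_inv G y"
proof -
  let ?S = "{n. gcomp G n x \<noteq> 0} \<union> {n. gcomp G n y \<noteq> 0}"
  have *: "finite ?S" using finite_gcomp by simp
  show ?thesis
    by (subst (1 2 3) grading_inv_superset[OF *])
      (auto simp: gcomp_add sgnp_add sum.distrib)
qed

lemma grading_inv_homogeneous: "x \<in> G n \<Longrightarrow> grading_inv G x = sgnp n x"
  by (subst grading_inv_superset[of "{n}"]) (auto simp: gcomp_homogeneous)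

lemma sgnp_scale: "sgnp n (sc c x) = sc c (sgnp n x)"
  by (simp add: sgnp_def)

lemma grading_inv_scale: "grading_inv G (sc c x) = sc c (grading_inv G x)"
  by (subst grading_inv_superset[of "{n. gcomp G n x \<noteq> 0}"])
    (auto simp: finite_gcomp gcomp_scale sgnp_scale grading_inv_def scale_sum_right)

end

lemma total_graded_space_shift:
  assumes "total_graded_space sc G"
  shows "total_graded_space sc (shift G s)"
proof -
  interpret total_graded_space sc G by fact
  have re: "(\<Sum>n\<in>{n. c (n - s) \<noteq> 0}. c (n - s)) = (\<Sum>n\<in>{n. c n \<noteq> 0}. c n)"
    and fin: "finite {n. c n \<noteq> 0} \<Longrightarrow> finite {n. c (n - s) \<noteq> 0}" for c :: "int \<Rightarrow> 'b"
  proof -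
    have eq: "{n. c (n - s) \<noteq> 0} = (\<lambda>n. n + s) ` {n. c n \<noteq> 0}"
      by (auto simp: image_iff) (metis diff_add_cancel)
    show "(\<Sum>n\<in>{n. c (n - s) \<noteq> 0}. c (n - s)) = (\<Sum>n\<in>{n. c n \<noteq> 0}. c n)"
      unfolding eq by (subst sum.reindex) (auto simp: inj_on_def)
    show "finite {n. c n \<noteq> 0} \<Longrightarrow> finite {n. c (n - s) \<noteq> 0}"
      unfolding eq by simp
  qed
  show ?thesis
  proof
    show "graded_space sc (shift G s)"
      unfolding graded_space_def
    proof (intro conjI allI impI)
      show "vector_space sc" ..
      show "subsp sc (shift G s n)" for n
        by (simp add: shift_def subsp_G)
      fix c :: "int \<Rightarrow> 'b" and n
      assume "finite {n. c n \<noteq> 0}" "\<forall>n. c n \<in> shift G s n" "(\<Sum>n\<in>{n. c n \<noteq> 0}. c n) = 0"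
      moreover from this have "c (n - s) \<in> G n" for n
        by (metis diff_add_cancel shift_def)
      ultimately have "decomp (\<lambda>n. c (n - s)) 0"
        unfolding decomp_def using re[of c] fin[of c] by simp
      from decomp_zero_unique[OF this, of "n + s"] show "c n = 0" by simp
    qed
    have "x \<in> gcarrier (shift G s)" for x
    proof -
      define c where "c n = gcomp G (n + s) x" for n
      have "finite {n. c n \<noteq> 0}"
        using finite_vimageI[OF finite_gcomp, of "\<lambda>n. n + s" x] by (simp add: c_def vimage_def inj_def)
      moreover have "c n \<in> shift G s n" for n
        by (simp add: c_def shift_def gcomp_in)
      moreover have "x = (\<Sum>n\<in>{n. c n \<noteq> 0}. c n)"
        using sum_gcomp[of x] re[of c] unfolding c_def by simp
      ultimately show ?thesis unfolding gcarrier_def by blast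
    qed
    then show "gcarrier (shift G s) = UNIV" by auto
  qed
qed

section \<open>Finitely supported sequences\<close>

definition single :: "nat \<Rightarrow> 'w \<Rightarrow> nat \<Rightarrow> 'w::zero" where
  "single j a = (\<lambda>n. if n = j then a else 0)"

definition finsupp :: "(nat \<Rightarrow> 'w::zero) \<Rightarrow> bool" where
  "finsupp x \<longleftrightarrow> finite {j. x j \<noteq> 0}"

text \<open>Linear extension of maps prescribed on monomials; all operations on polynomial forms are
  defined through it.\<close>

definition extend :: "(nat \<Rightarrow> 'w::zero \<Rightarrow> 'u::comm_monoid_add) \<Rightarrow> (nat \<Rightarrow> 'w) \<Rightarrow> 'u" where
  "extend f x = (\<Sum>j\<in>{j. x j \<noteq> 0}. f j (x j))"

lemma single_apply: "single j a n = (if n = j then a else 0)"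
  by (simp add: single_def)

lemma single_same [simp]: "single j a j = a"
  by (simp add: single_def)

lemma single_zero [simp]: "single j 0 = 0"
  by (rule ext) (simp add: single_def)

lemma single_add: "single j (a + b :: 'w::monoid_add) = single j a + single j b"
  by (rule ext) (simp add: single_def)

lemma single_uminus: "single j (- a :: 'w::group_add) = - single j a"
  by (rule ext) (simp add: single_def)

lemma single_diff: "single j (a - b :: 'w::group_add) = single j a - single j b"
  by (rule ext) (simp add: single_def)

lemma single_sgnp: "single j (sgnp n a) = sgnp n (single j a)"
  by (simp add: sgnp_def single_uminus)

lemma finsupp_0 [simp]: "finsupp 0"
  by (simp add: finsupp_def)

lemma finsupp_single [simp]: "finsupp (single j a)"
  unfolding finsupp_def by (rule finite_subset[of _ "{j}"]) (auto simp: single_def)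

lemma finsupp_add [simp]:
  fixes x y :: "nat \<Rightarrow> 'w::monoid_add"
  assumes "finsupp x" "finsupp y"
  shows "finsupp (x + y)"
  unfolding finsupp_def by (rule finite_subset[of _ "{j. x j \<noteq> 0} \<union> {j. y j \<noteq> 0}"])
    (use assms in \<open>auto simp: finsupp_def\<close>)

lemma finsupp_uminus [simp]: "finsupp x \<Longrightarrow> finsupp (- x :: nat \<Rightarrow> 'w::group_add)"
  by (simp add: finsupp_def)

lemma finsupp_diff [simp]:
  "finsupp x \<Longrightarrow> finsupp y \<Longrightarrow> finsupp (x - y :: nat \<Rightarrow> 'w::ab_group_add)"
  using finsupp_add[of x "- y"] by simp

lemma sum_closed:
  assumes "Q 0" "\<And>x y. Q x \<Longrightarrow> Q y \<Longrightarrow> Q (x + y)" "\<And>j. Q (f j)"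
  shows "Q (sum f S)"
  by (induction S rule: infinite_finite_induct) (auto intro: assms)

lemma sum_apply: "sum f S n = (\<Sum>j\<in>S. f j n)"
  for f :: "'i \<Rightarrow> nat \<Rightarrow> 'w::comm_monoid_add"
  by (induction S rule: infinite_finite_induct) simp_all

lemma finsupp_decomp:
  fixes x :: "nat \<Rightarrow> 'w::comm_monoid_add"
  assumes "finsupp x"
  shows "x = (\<Sum>j\<in>{j. x j \<noteq> 0}. single j (x j))"
proof
  fix n
  have "(\<Sum>j\<in>{j. x j \<noteq> 0}. single j (x j)) n = (\<Sum>j\<in>{j. x j \<noteq> 0}. single j (x j) n)"
    by (rule sum_apply)
  also have "\<dots> = x n"
    using assms by (simp add: single_def finsupp_def sum.delta)
  finally show "x n = (\<Sum>j\<in>{j. x j \<noteq> 0}. single j (x j)) n" by simp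
qed

text \<open>The last premise concerns only the monomials of the given \<open>x\<close>, so that
  degree information about its entries survives; \<open>path_deg_induct\<close> relies on
  this.\<close>

lemma finsupp_induct:
  fixes x :: "nat \<Rightarrow> 'w::comm_monoid_add"
  assumes "finsupp x" "P 0"
    and "\<And>x y. finsupp x \<Longrightarrow> finsupp y \<Longrightarrow> P x \<Longrightarrow> P y \<Longrightarrow> P (x + y)"
    and "\<And>j. P (single j (x j))"
  shows "P x"
proof -
  have "(\<lambda>y. finsupp y \<and> P y) (\<Sum>j\<in>S. single j (x j))" for S
    by (rule sum_closed[where Q = "\<lambda>y. finsupp y \<and> P y"]) (auto simp: assms)
  then show ?thesis using finsupp_decomp[OF assms(1)] by metis
qed

lemma extend_superset:
  assumes "finite S" "{j. x j \<noteq> 0} \<subseteq> S" "\<And>j. f j 0 = 0"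
  shows "extend f x = (\<Sum>j\<in>S. f j (x j))"
  unfolding extend_def using assms by (intro sum.mono_neutral_left) auto

lemma extend_0 [simp]: "extend f 0 = 0"
  by (simp add: extend_def)

lemma extend_single: "f j 0 = 0 \<Longrightarrow> extend f (single j a) = f j a"
  by (cases "a = 0") (simp_all add: extend_def single_def)

lemma extend_add:
  fixes f :: "nat \<Rightarrow> 'w::ab_group_add \<Rightarrow> 'u::ab_group_add"
  assumes "finsupp x" "finsupp y" and f: "\<And>j a b. f j (a + b) = f j a + f j b"
  shows "extend f (x + y) = extend f x + extend f y"
proof -
  let ?S = "{j. x j \<noteq> 0} \<union> {j. y j \<noteq> 0}"
  have *: "finite ?S" using assms by (simp add: finsupp_def)
  have f0: "f j 0 = 0" for j using f[of j 0 0] by simp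
  show ?thesis
    by (subst (1 2 3) extend_superset[OF *]) (auto simp: f0 f sum.distrib)
qed

lemma extend_fun_add: "extend (\<lambda>j a. f j a + g j a) x = extend f x + extend g x"
  by (simp add: extend_def sum.distrib)

lemma extend_in:
  assumes "subsp sc S" "\<And>j. f j (x j) \<in> S"
  shows "extend f x \<in> S"
  unfolding extend_def using assms by (intro subsp_sum)

lemma sc_fun_apply: "sc_fun sc c x i = sc c (x i)"
  by (simp add: sc_fun_def)

lemma vector_space_sc_fun: "vector_space sc \<Longrightarrow> vector_space (sc_fun sc)"
  by (simp add: vector_space_def sc_fun_def fun_eq_iff)

lemma sc_fun_single: "vector_space sc \<Longrightarrow> sc_fun sc c (single j a) = single j (sc c a)"
  by (rule ext) (simp add: sc_fun_def single_def module.scale_zero_right[OF module_iff_vector_space[THEN iffD2]])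

lemma extend_scale:
  assumes "vector_space sc" and f: "\<And>j a. f j (sc c a) = sc' c (f j a)" and "\<And>j. f j 0 = 0"
    and "vector_space sc'" "finsupp x"
  shows "extend f (sc_fun sc c x) = sc' c (extend f x)"
  using assms
  by (subst extend_superset[of "{j. x j \<noteq> 0}"])
    (auto simp: finsupp_def sc_fun_def extend_def module.scale_sum_right[OF module_iff_vector_space[THEN iffD2]] module.scale_zero_right[OF module_iff_vector_space[THEN iffD2]])

section \<open>The path object of a DGLA with exact bracket\<close>

text \<open>Degrees are those of the shifted grading: the bracket has degree 0 and \<open>q\<close>
  has degree -1. The assumptions \<open>br_eq\<close> and \<open>q_br\<close> are the
  \<open>dt\<close> components of the Leibniz and Jacobi identities for
  \<open>t [,] - dt q\<close>.\<close>

locale homotopically_trivial_bracket = total_graded_space sc L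
  for sc :: "'k::field_char_0 \<Rightarrow> 'w::ab_group_add \<Rightarrow> 'w" and L :: "int \<Rightarrow> 'w set" +
  fixes br q :: "'w \<Rightarrow> 'w \<Rightarrow> 'w" and d :: "'w \<Rightarrow> 'w"
  assumes dgla: "dgla sc L br d"
    and q_add_left: "q (x + y) z = q x z + q y z"
    and q_add_right: "q x (y + z) = q x y + q x z"
    and q_scale_left: "q (sc c x) y = sc c (q x y)"
    and q_scale_right: "q x (sc c y) = sc c (q x y)"
    and q_degree: "x \<in> L m \<Longrightarrow> y \<in> L n \<Longrightarrow> q x y \<in> L (m + n - 1)"
    and q_anti: "x \<in> L m \<Longrightarrow> y \<in> L n \<Longrightarrow> q x y = - sgnp (m * n) (q y x)"
    and br_eq: "x \<in> L m \<Longrightarrow> br x y = - (d (q x y) + q (d x) y + sgnp m (q x (d y)))"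
    and q_br: "x \<in> L m \<Longrightarrow> y \<in> L n \<Longrightarrow>
      q x (br y z) + sgnp m (br x (q y z)) =
      q (br x y) z + br (q x y) z + sgnp (m * n) (q y (br x z) + sgnp n (br y (q x z)))"
begin

lemma br_add_left: "br (x + y) z = br x z + br y z"
  using dgla unfolding dgla_def lin_on_def hom_map_def total by (elim conjE) (meson UNIV_I)
lemma br_add_right: "br x (y + z) = br x y + br x z"
  using dgla unfolding dgla_def lin_on_def hom_map_def total by (elim conjE) (meson UNIV_I)
lemma br_scale_left: "br (sc c x) y = sc c (br x y)"
  using dgla unfolding dgla_def lin_on_def hom_map_def total by (elim conjE) (meson UNIV_I)
lemma br_scale_right: "br x (sc c y) = sc c (br x y)"
  using dgla unfolding dgla_def lin_on_def hom_map_def total by (elim conjE) (meson UNIV_I)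
lemma br_degree: "x \<in> L m \<Longrightarrow> y \<in> L n \<Longrightarrow> br x y \<in> L (m + n)"
  using dgla unfolding dgla_def lin_on_def hom_map_def total by (elim conjE) (meson UNIV_I)
lemma br_anti: "x \<in> L m \<Longrightarrow> y \<in> L n \<Longrightarrow> br x y = - sgnp (m * n) (br y x)"
  using dgla unfolding dgla_def lin_on_def hom_map_def total by (elim conjE) (meson UNIV_I)
lemma br_jacobi: "x \<in> L m \<Longrightarrow> y \<in> L n \<Longrightarrow> br x (br y z) = br (br x y) z + sgnp (m * n) (br y (br x z))"
  using dgla unfolding dgla_def lin_on_def hom_map_def total by (elim conjE) (meson UNIV_I)
lemma d_add: "d (x + y) = d x + d y"
  using dgla unfolding dgla_def lin_on_def hom_map_def total by (elim conjE) (meson UNIV_I)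
lemma d_scale: "d (sc c x) = sc c (d x)"
  using dgla unfolding dgla_def lin_on_def hom_map_def total by (elim conjE) (meson UNIV_I)
lemma d_degree: "x \<in> L m \<Longrightarrow> d x \<in> L (m + 1)"
  using dgla unfolding dgla_def lin_on_def hom_map_def total by (elim conjE) (meson UNIV_I)
lemma d_d: "d (d x) = 0"
  using dgla unfolding dgla_def lin_on_def hom_map_def total by (elim conjE) (meson UNIV_I)
lemma d_br: "x \<in> L m \<Longrightarrow> d (br x y) = br (d x) y + sgnp m (br x (d y))"
  using dgla unfolding dgla_def lin_on_def hom_map_def total by (elim conjE) (meson UNIV_I)

lemma br_uminus_left: "br (- x) y = - br x y"
  using br_scale_left[of "-1"] by simp
lemma br_uminus_right: "br x (- y) = - br x y"
  using br_scale_right[of x "-1"] by simp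
lemma q_uminus_left: "q (- x) y = - q x y"
  using q_scale_left[of "-1"] by simp
lemma q_uminus_right: "q x (- y) = - q x y"
  using q_scale_right[of x "-1"] by simp
lemma d_uminus: "d (- x) = - d x"
  using d_scale[of "-1"] by simp
lemma br_0 [simp]: "br 0 x = 0" "br x 0 = 0"
  using br_scale_left[of 0] br_scale_right[of x 0] by simp_all
lemma q_0 [simp]: "q 0 x = 0" "q x 0 = 0"
  using q_scale_left[of 0] q_scale_right[of x 0] by simp_all
lemma d_0 [simp]: "d 0 = 0"
  using d_scale[of 0] by simp
lemma inv_0 [simp]: "grading_inv L 0 = 0"
  using grading_inv_scale[of 0 0] by simp

lemmas bilin = br_add_left br_add_right br_uminus_left br_uminus_right br_scale_left br_scale_right
  q_add_left q_add_right q_uminus_left q_uminus_right q_scale_left q_scale_right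
  d_add d_uminus d_scale d_d

lemma vs: "vector_space sc" ..

lemma vsf: "vector_space (sc_fun sc)"
  using vs by (rule vector_space_sc_fun)

text \<open>The polynomial forms \<open>A[t,dt]\<close> are encoded as sequences: \<open>single (2 * n) a\<close> stands for
  \<open>t\<^sup>n a\<close> and \<open>single (2 * n + 1) a\<close> for \<open>dt t\<^sup>n a\<close>, with \<open>dt\<close> of degree one on the left.\<close>

definition path_deg :: "int \<Rightarrow> (nat \<Rightarrow> 'w) set" where
  "path_deg n = {x. finsupp x \<and> (\<forall>j. x j \<in> L (n - int (j mod 2)))}"

text \<open>The minus sign comes from moving \<open>d\<close> past \<open>dt\<close>. For
  \<open>j = 0\<close> the truncated index \<open>j - 1\<close> is 0 and has the wrong parity, but
  its coefficient is zero.\<close>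

definition path_d_gen :: "nat \<Rightarrow> 'w \<Rightarrow> nat \<Rightarrow> 'w" where
  "path_d_gen j a =
     (if even j then single j (d a) + single (j - 1) (sc (of_nat (j div 2)) a) else - single j (d a))"

definition path_d :: "(nat \<Rightarrow> 'w) \<Rightarrow> nat \<Rightarrow> 'w" where
  "path_d x = extend path_d_gen x"

text \<open>An offset of 2 in the index is the factor \<open>t\<close> of \<open>t [,]\<close>, an
  offset of 1 the factor \<open>dt\<close> of \<open>- dt q\<close>. Moving the \<open>dt\<close> of
  the second argument past \<open>a\<close> costs the sign \<open>grading_inv L a\<close>; all terms
  with two factors \<open>dt\<close> vanish.\<close>

definition path_br_gen :: "nat \<Rightarrow> 'w \<Rightarrow> nat \<Rightarrow> 'w \<Rightarrow> nat \<Rightarrow> 'w" where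
  "path_br_gen i a j b =
     (if even i then
        if even j then single (i + j + 2) (br a b) - single (i + j + 1) (q a b)
        else single (i + j + 2) (br (grading_inv L a) b)
      else if even j then single (i + j + 2) (br a b) else 0)"

definition path_br :: "(nat \<Rightarrow> 'w) \<Rightarrow> (nat \<Rightarrow> 'w) \<Rightarrow> nat \<Rightarrow> 'w" where
  "path_br x y = extend (\<lambda>i a. extend (path_br_gen i a) y) x"

lemma single_scale: "single j (sc c a) = sc_fun sc c (single j a)"
  by (simp add: sc_fun_single vs)

sublocale F: vector_space "sc_fun sc" by (rule vsf)

lemma path_d_gen_add: "path_d_gen j (a + b) = path_d_gen j a + path_d_gen j b"
  by (simp add: path_d_gen_def d_add single_add scale_right_distrib)

lemma path_d_gen_scale: "path_d_gen j (sc c a) = sc_fun sc c (path_d_gen j a)"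
  by (simp add: path_d_gen_def d_scale sc_fun_single vs F.scale_right_distrib mult.commute
      flip: single_uminus)

lemma path_d_gen_0 [simp]: "path_d_gen j 0 = 0"
  by (simp add: path_d_gen_def)

lemma path_d_add: "finsupp x \<Longrightarrow> finsupp y \<Longrightarrow> path_d (x + y) = path_d x + path_d y"
  by (simp add: path_d_def extend_add path_d_gen_add)

lemma path_d_scale: "finsupp x \<Longrightarrow> path_d (sc_fun sc c x) = sc_fun sc c (path_d x)"
  unfolding path_d_def by (rule extend_scale[OF vs path_d_gen_scale path_d_gen_0 vsf])

lemma path_d_single: "path_d (single j a) = path_d_gen j a"
  by (simp add: path_d_def extend_single)

lemma path_br_gen_add_left: "path_br_gen i (a + a') j b = path_br_gen i a j b + path_br_gen i a' j b"
  by (simp add: path_br_gen_def bilin single_add grading_inv_add)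

lemma path_br_gen_add_right: "path_br_gen i a j (b + b') = path_br_gen i a j b + path_br_gen i a j b'"
  by (simp add: path_br_gen_def bilin single_add)

lemma path_br_gen_scale_left: "path_br_gen i (sc c a) j b = sc_fun sc c (path_br_gen i a j b)"
  by (simp add: path_br_gen_def bilin single_scale grading_inv_scale F.scale_right_diff_distrib)

lemma path_br_gen_scale_right: "path_br_gen i a j (sc c b) = sc_fun sc c (path_br_gen i a j b)"
  by (simp add: path_br_gen_def bilin single_scale F.scale_right_diff_distrib)

lemma path_br_gen_0 [simp]: "path_br_gen i 0 j b = 0" "path_br_gen i a j 0 = 0"
  by (simp_all add: path_br_gen_def)

lemma path_br_add_left:
  "finsupp x \<Longrightarrow> finsupp x' \<Longrightarrow> path_br (x + x') y = path_br x y + path_br x' y"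
  unfolding path_br_def
  by (rule extend_add) (simp_all add: extend_def[of _ y] path_br_gen_add_left sum.distrib)

lemma path_br_add_right:
  "finsupp y \<Longrightarrow> finsupp y' \<Longrightarrow> path_br x (y + y') = path_br x y + path_br x y'"
  unfolding path_br_def
  by (simp add: extend_add path_br_gen_add_right extend_fun_add)

lemma path_br_scale_left:
  assumes "finsupp x"
  shows "path_br (sc_fun sc c x) y = sc_fun sc c (path_br x y)"
  unfolding path_br_def
proof (rule extend_scale[OF vs _ _ vsf assms])
  show "extend (path_br_gen j (sc c a)) y = sc_fun sc c (extend (path_br_gen j a) y)" for j a
    by (simp add: extend_def F.scale_sum_right path_br_gen_scale_left)
  show "extend (path_br_gen j 0) y = 0" for j
    by (simp add: extend_def)
qed

lemma path_br_scale_right: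
  assumes "finsupp y"
  shows "path_br x (sc_fun sc c y) = sc_fun sc c (path_br x y)"
proof -
  have "extend (path_br_gen i a) (sc_fun sc c y) = sc_fun sc c (extend (path_br_gen i a) y)" for i a
    by (rule extend_scale[OF vs path_br_gen_scale_right path_br_gen_0(2) vsf assms])
  then show ?thesis
    by (simp add: path_br_def extend_def[of _ x] F.scale_sum_right)
qed

lemma path_br_single: "path_br (single i a) (single j b) = path_br_gen i a j b"
proof -
  have "extend (path_br_gen i 0) (single j b) = 0"
    by (simp add: extend_def)
  then show ?thesis
    by (simp add: path_br_def extend_single)
qed


section \<open>Grading of the polynomial forms\<close>

lemma subsp_path_deg: "subsp (sc_fun sc) (path_deg n)"
proof -
  have "finsupp (sc_fun sc c x)" if "finsupp x" for c x
    using that unfolding finsupp_def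
    by (rule finite_subset[rotated]) (auto simp: sc_fun_def)
  then show ?thesis
    by (auto simp: subsp_def path_deg_def G_closed sc_fun_def)
qed

lemma path_deg_closed:
  "x \<in> path_deg n \<Longrightarrow> y \<in> path_deg n \<Longrightarrow> x + y \<in> path_deg n"
  "x \<in> path_deg n \<Longrightarrow> sc_fun sc c x \<in> path_deg n"
  "0 \<in> path_deg n"
  using subsp_path_deg by (auto simp: subsp_def)

lemma path_deg_uminus: "x \<in> path_deg n \<Longrightarrow> - x \<in> path_deg n"
  by (simp add: path_deg_def G_uminus)

lemma path_deg_diff: "x \<in> path_deg n \<Longrightarrow> y \<in> path_deg n \<Longrightarrow> x - y \<in> path_deg n"
  by (simp add: path_deg_def G_diff)

lemma path_deg_finsupp: "x \<in> path_deg n \<Longrightarrow> finsupp x"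
  by (simp add: path_deg_def)

lemma path_deg_nth: "x \<in> path_deg n \<Longrightarrow> x j \<in> L (n - int (j mod 2))"
  by (simp add: path_deg_def)

lemma path_deg_single: "a \<in> L (n - int (j mod 2)) \<Longrightarrow> single j a \<in> path_deg n"
  by (auto simp: path_deg_def single_apply)

text \<open>The forms do not fill their universe type, so the identities below are proved under
  \<open>finsupp\<close>; this lemma carries them over to the carrier.\<close>

lemma gcarrier_path_finsupp: "x \<in> gcarrier path_deg \<Longrightarrow> finsupp x"
proof -
  assume "x \<in> gcarrier path_deg"
  then obtain c where "\<And>n. c n \<in> path_deg n" "x = (\<Sum>n\<in>{n. c n \<noteq> 0}. c n)"
    unfolding gcarrier_def by blast
  then show "finsupp x"
    using sum_closed[where Q = finsupp and f = c, OF finsupp_0 finsupp_add] path_deg_finsupp by metis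
qed

text \<open>Directness is checked coordinate by coordinate: the \<open>j\<close>-th entries of a
  family of forms are a homogeneous family in \<open>L\<close> shifted by the parity of
  \<open>j\<close>.\<close>

lemma graded_path: "graded_space (sc_fun sc) path_deg"
  unfolding graded_space_def
proof (intro conjI allI impI)
  show "vector_space (sc_fun sc)" by (rule vsf)
  show "subsp (sc_fun sc) (path_deg n)" for n by (rule subsp_path_deg)
  fix c :: "int \<Rightarrow> nat \<Rightarrow> 'w" and n
  assume fin: "finite {n. c n \<noteq> 0}" and c: "\<forall>n. c n \<in> path_deg n"
    and sum: "(\<Sum>n\<in>{n. c n \<noteq> 0}. c n) = 0"
  show "c n = 0"
  proof
    fix j
    interpret S: total_graded_space sc "shift L (- int (j mod 2))"
      by (rule total_graded_space_shift) unfold_locales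
    have "S.decomp (\<lambda>n. c n j) 0"
    proof (rule S.decomp_I[OF fin])
      show "{n. c n j \<noteq> 0} \<subseteq> {n. c n \<noteq> 0}" by auto
      show "c n j \<in> shift L (- int (j mod 2)) n" for n
        using c path_deg_nth[of "c n" n j] by (simp add: shift_def)
      show "0 = (\<Sum>n\<in>{n. c n \<noteq> 0}. c n j)"
        using arg_cong[OF sum, of "\<lambda>f. f j"] by (simp only: sum_apply zero_fun_apply)
    qed
    then show "c n j = 0 j"
      using S.decomp_zero_unique by simp
  qed
qed

lemma path_deg_induct:
  assumes "x \<in> path_deg n" "P 0"
    and "\<And>x y. finsupp x \<Longrightarrow> finsupp y \<Longrightarrow> P x \<Longrightarrow> P y \<Longrightarrow> P (x + y)"
    and "\<And>j a. a \<in> L (n - int (j mod 2)) \<Longrightarrow> P (single j a)"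
  shows "P x"
proof (rule finsupp_induct[where P = P, OF path_deg_finsupp[OF assms(1)]])
  show "P (single j (x j))" for j
    by (rule assms(4)) (rule path_deg_nth[OF assms(1)])
qed (fact assms)+

lemma path_d_degree: "x \<in> path_deg n \<Longrightarrow> path_d x \<in> path_deg (n + 1)"
  unfolding path_d_def
proof (rule extend_in[OF subsp_path_deg])
  fix j assume "x \<in> path_deg n"
  from path_deg_nth[OF this, of j] have x: "x j \<in> L (n - int (j mod 2))" .
  show "path_d_gen j (x j) \<in> path_deg (n + 1)"
  proof (cases "even j")
    case True
    then have "single (j - 1) (sc (of_nat (j div 2)) (x j)) \<in> path_deg (n + 1)"
      using x by (cases "j = 0") (auto intro!: path_deg_single G_scale path_deg_closed simp: mod2_eq_if)
    then show ?thesis using True x d_degree[OF x]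
      by (auto simp: path_d_gen_def intro!: path_deg_closed path_deg_single)
  next
    case False
    then show ?thesis using x d_degree[OF x]
      by (auto simp: path_d_gen_def mod2_eq_if intro!: path_deg_uminus path_deg_single)
  qed
qed

lemma path_br_degree:
  assumes "x \<in> path_deg m" "y \<in> path_deg n"
  shows "path_br x y \<in> path_deg (m + n)"
  unfolding path_br_def
proof (intro extend_in[OF subsp_path_deg])
  fix i j
  from path_deg_nth[OF assms(1), of i] have x: "x i \<in> L (m - int (i mod 2))" .
  from path_deg_nth[OF assms(2), of j] have y: "y j \<in> L (n - int (j mod 2))" .
  show "path_br_gen i (x i) j (y j) \<in> path_deg (m + n)"
    using br_degree[OF x y] q_degree[OF x y] br_degree[OF G_sgnp[OF x] y]
    by (cases "even i"; cases "even j")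
     (auto simp: path_br_gen_def mod2_eq_if grading_inv_homogeneous[OF x] algebra_simps
      intro!: path_deg_diff path_deg_single path_deg_closed(3))
qed

lemma finsupp_path_d_gen [simp]: "finsupp (path_d_gen j a)"
  by (simp add: path_d_gen_def)

lemma finsupp_path_br_gen [simp]: "finsupp (path_br_gen i a j b)"
  by (simp add: path_br_gen_def)

lemma finsupp_extend: "(\<And>j. finsupp (f j (x j))) \<Longrightarrow> finsupp (extend f x)"
  for f :: "nat \<Rightarrow> 'a::comm_monoid_add \<Rightarrow> nat \<Rightarrow> 'b::comm_monoid_add"
  unfolding extend_def by (rule sum_closed[where Q = finsupp]) auto

lemma finsupp_path_d [simp]: "finsupp (path_d x)"
  unfolding path_d_def by (intro finsupp_extend) simp

lemma finsupp_path_br [simp]: "finsupp (path_br x y)"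
  unfolding path_br_def by (intro finsupp_extend) simp

lemma path_d_0 [simp]: "path_d 0 = 0"
  by (simp add: path_d_def)

lemma path_br_0 [simp]: "path_br 0 x = 0" "path_br x 0 = 0"
  by (simp_all add: path_br_def) (simp add: extend_def)

lemma path_d_uminus: "finsupp x \<Longrightarrow> path_d (- x) = - path_d x"
  using path_d_scale[of x "-1"] F.scale_minus_left[of 1] by simp
lemma path_d_diff: "finsupp x \<Longrightarrow> finsupp y \<Longrightarrow> path_d (x - y) = path_d x - path_d y"
  using path_d_add[of x "- y"] by (simp add: path_d_uminus)
lemma path_br_uminus_left: "finsupp x \<Longrightarrow> path_br (- x) y = - path_br x y"
  using path_br_scale_left[of x "-1"] by simp
lemma path_br_uminus_right: "finsupp y \<Longrightarrow> path_br x (- y) = - path_br x y"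
  using path_br_scale_right[of y x "-1"] by simp
lemma path_br_diff_left:
  "finsupp x \<Longrightarrow> finsupp x' \<Longrightarrow> path_br (x - x') y = path_br x y - path_br x' y"
  using path_br_add_left[of x "- x'"] by (simp add: path_br_uminus_left)
lemma path_br_diff_right:
  "finsupp y \<Longrightarrow> finsupp y' \<Longrightarrow> path_br x (y - y') = path_br x y - path_br x y'"
  using path_br_add_right[of y "- y'"] by (simp add: path_br_uminus_right)

lemmas path_bilin = path_d_add path_d_uminus path_d_diff
  path_br_add_left path_br_add_right path_br_uminus_left path_br_uminus_right
  path_br_diff_left path_br_diff_right path_d_single path_br_single

section \<open>DGLA axioms for the polynomial forms\<close>

lemma path_d_d:
  assumes "finsupp x"
  shows "path_d (path_d x) = 0"
proof (rule finsupp_induct[where P = "\<lambda>x. path_d (path_d x) = 0", OF assms])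
  fix j
  show "path_d (path_d (single j (x j))) = 0"
  proof (cases "even j \<and> j > 0")
    case True
    then have "odd (j - 1)" by auto
    with True show ?thesis
      by (simp add: path_bilin path_d_gen_def d_scale d_d)
  next
    case False
    then show ?thesis
      by (auto simp: path_bilin path_d_gen_def d_scale d_d)
  qed
qed (simp_all add: path_bilin)

lemma path_br_anti:
  assumes x: "x \<in> path_deg m" and y: "y \<in> path_deg n"
  shows "path_br x y = - sgnp (m * n) (path_br y x)"
proof (rule path_deg_induct[where P = "\<lambda>x. path_br x y = - sgnp (m * n) (path_br y x)", OF x])
  fix i a assume a: "a \<in> L (m - int (i mod 2))"
  show "path_br (single i a) y = - sgnp (m * n) (path_br y (single i a))"
  proof (rule path_deg_induct[where
        P = "\<lambda>y. path_br (single i a) y = - sgnp (m * n) (path_br y (single i a))", OF y])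
    fix j b assume b: "b \<in> L (n - int (j mod 2))"
    have ji: "j + i = i + j" by simp
    show "path_br (single i a) (single j b) = - sgnp (m * n) (path_br (single j b) (single i a))"
      by (cases "even i"; cases "even j"; cases "even m"; cases "even n")
        (simp_all add: path_br_single path_br_gen_def ji grading_inv_homogeneous[OF a]
          br_anti[OF a b] q_anti[OF a b] grading_inv_homogeneous[OF b] mod2_eq_if sgnp_def single_uminus
          br_uminus_left)
  qed (simp_all add: path_bilin sgnp_add)
qed (simp_all add: path_bilin sgnp_add)


text \<open>On monomials without \<open>dt\<close>, the part free of \<open>dt\<close> is the Jacobi
  identity of \<open>br\<close> and the part linear in \<open>dt\<close> is \<open>q_br\<close>. If
  one argument contains \<open>dt\<close>, the identity is that of \<open>br\<close> up to signs; if
  two do, both sides vanish.\<close>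

lemma path_br_jacobi:
  assumes x: "x \<in> path_deg m" and y: "y \<in> path_deg n" and z: "finsupp z"
  shows "path_br x (path_br y z) =
    path_br (path_br x y) z + sgnp (m * n) (path_br y (path_br x z))"
proof (rule path_deg_induct[where P = "\<lambda>x. path_br x (path_br y z) =
    path_br (path_br x y) z + sgnp (m * n) (path_br y (path_br x z))", OF x])
  fix i a assume a: "a \<in> L (m - int (i mod 2))"
  let ?x = "single i a"
  show "path_br ?x (path_br y z) = path_br (path_br ?x y) z + sgnp (m * n) (path_br y (path_br ?x z))"
  proof (rule path_deg_induct[where P = "\<lambda>y. path_br ?x (path_br y z) =
      path_br (path_br ?x y) z + sgnp (m * n) (path_br y (path_br ?x z))", OF y])
    fix j b assume b: "b \<in> L (n - int (j mod 2))"
    let ?y = "single j b"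
    show "path_br ?x (path_br ?y z) =
        path_br (path_br ?x ?y) z + sgnp (m * n) (path_br ?y (path_br ?x z))"
    proof (rule finsupp_induct[where P = "\<lambda>z. path_br ?x (path_br ?y z) =
        path_br (path_br ?x ?y) z + sgnp (m * n) (path_br ?y (path_br ?x z))", OF z])
      fix l
      define c where "c = z l"
      have ab: "br a b \<in> L (m + n - int (i mod 2) - int (j mod 2))"
        using br_degree[OF a b] by (simp add: algebra_simps)
      note J = br_jacobi[OF a b, of c]
      \<comment> \<open>\<open>q_br\<close> solved for its first term, so that it can serve as a
        rewrite rule.\<close>
      have K': "q a (br b c) = q (br a b) c + br (q a b) c +
          sgnp ((m - int (i mod 2)) * (n - int (j mod 2))) (q b (br a c) + sgnp (n - int (j mod 2)) (br b (q a c)))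
          - sgnp (m - int (i mod 2)) (br a (q b c))"
        using q_br[OF a b, of c] by (simp add: algebra_simps)
      show "path_br ?x (path_br ?y (single l (z l))) =
        path_br (path_br ?x ?y) (single l (z l)) + sgnp (m * n) (path_br ?y (path_br ?x (single l (z l))))"
        unfolding c_def[symmetric]
        by (cases "even i"; cases "even j"; cases "even l"; cases "even m"; cases "even n")
          (simp_all add: path_bilin path_br_gen_def grading_inv_homogeneous[OF a]
            grading_inv_homogeneous[OF b] grading_inv_homogeneous[OF ab] mod2_eq_if sgnp_def
            single_uminus single_add single_diff bilin J K' add_ac)
    qed (simp_all add: path_bilin sgnp_add algebra_simps)
  qed (simp_all add: path_bilin sgnp_add algebra_simps z)
qed (simp_all add: path_bilin sgnp_add algebra_simps z)

text \<open>Handles the term \<open>dt n t^(n-1) a\<close> of a derivative uniformly: at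
  \<open>i = 0\<close> the index \<open>i - 1\<close> is even instead of odd, but the zero
  coefficient annihilates both sides.\<close>

lemma path_br_gen_pred_left:
  "even i \<Longrightarrow> path_br_gen (i - 1) (sc (of_nat (i div 2)) a) j b =
    (if even j then single (i + j + 1) (sc (of_nat (i div 2)) (br a b)) else 0)"
  by (cases i) (auto simp: path_br_gen_def bilin)

lemma path_br_gen_pred_right:
  "even j \<Longrightarrow> path_br_gen i a (j - 1) (sc (of_nat (j div 2)) b) =
    (if even i then single (i + j + 1) (sc (of_nat (j div 2)) (br (grading_inv L a) b)) else 0)"
  by (cases j) (auto simp: path_br_gen_def bilin)

lemma path_d_br:
  assumes x: "x \<in> path_deg m" and y: "finsupp y"
  shows "path_d (path_br x y) = path_br (path_d x) y + sgnp m (path_br x (path_d y))"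
proof (rule path_deg_induct[where P = "\<lambda>x. path_d (path_br x y) =
    path_br (path_d x) y + sgnp m (path_br x (path_d y))", OF x])
  fix i a assume a: "a \<in> L (m - int (i mod 2))"
  let ?x = "single i a"
  show "path_d (path_br ?x y) = path_br (path_d ?x) y + sgnp m (path_br ?x (path_d y))"
  proof (rule finsupp_induct[where P = "\<lambda>y. path_d (path_br ?x y) =
    path_br (path_d ?x) y + sgnp m (path_br ?x (path_d y))", OF y])
    fix j
    define b where "b = y j"
    note da = d_degree[OF a]
    show "path_d (path_br ?x (single j (y j))) =
        path_br (path_d ?x) (single j (y j)) + sgnp m (path_br ?x (path_d (single j (y j))))"
    proof -
      \<comment> \<open>The bracket of two even monomials has exponent
        \<open>i div 2 + j div 2 + 1\<close> in its part without \<open>dt\<close>. The first two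
        summands match the derivatives of the factors; the extra 1 leaves a term
        \<open>dt [a,b]\<close>.\<close>
      have half: "even i \<Longrightarrow> even j \<Longrightarrow>
          (of_nat (Suc (i + j) div 2) :: 'k) = of_nat (i div 2) + of_nat (j div 2)"
        by (auto elim!: evenE)
      \<comment> \<open>Exactness of the bracket, oriented to cancel this extra term.\<close>
      have E: "q (d a) b = - br a b - d (q a b) - sgnp (m - int (i mod 2)) (q a (d b))"
        by (subst br_eq[OF a]) simp
      have da': "even i \<Longrightarrow> d a \<in> L (m + 1)" "odd i \<Longrightarrow> d a \<in> L m"
        using da by (simp_all add: mod2_eq_if)
      show ?thesis
        unfolding b_def[symmetric]
        by (cases "even i"; cases "even j"; cases "even m")
          (simp_all add: path_bilin path_d_gen_def path_br_gen_pred_left[simplified] path_br_gen_pred_right[simplified]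
            path_br_gen_def[of i _ j] half grading_inv_homogeneous[OF a]
            grading_inv_homogeneous[OF da'(1)] d_br[OF a] E mod2_eq_if sgnp_def
            scale_left_distrib single_uminus single_add single_diff bilin)
    qed
  qed (simp_all add: path_bilin sgnp_add algebra_simps)
qed (simp_all add: path_bilin sgnp_add algebra_simps y)

lemma dgla_path: "dgla (sc_fun sc) path_deg path_br path_d"
  unfolding dgla_def lin_on_def hom_map_def
  by (intro conjI allI impI ballI graded_path path_br_degree path_br_jacobi path_br_anti path_d_br
      path_d_degree path_d_d path_br_add_left path_br_add_right path_br_scale_left path_br_scale_right
      path_d_add path_d_scale gcarrier_path_finsupp; assumption)


section \<open>Fibres of the path object over the points of the line\<close>

definition const_deg :: "int \<Rightarrow> (nat \<Rightarrow> 'w) set" where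
  "const_deg n = single 0 ` L n"

text \<open>The bracket on the fibre at \<open>t = c\<close>: the original one for
  \<open>c = 1\<close>, the abelian one for \<open>c = 0\<close>.\<close>

definition const_br :: "'k \<Rightarrow> (nat \<Rightarrow> 'w) \<Rightarrow> (nat \<Rightarrow> 'w) \<Rightarrow> nat \<Rightarrow> 'w" where
  "const_br c x y = single 0 (sc c (br (x 0) (y 0)))"

definition const_d :: "(nat \<Rightarrow> 'w) \<Rightarrow> nat \<Rightarrow> 'w" where
  "const_d x = single 0 (d (x 0))"

lemma const_deg_path_deg: "x \<in> const_deg n \<Longrightarrow> x \<in> path_deg n"
  by (auto simp: const_deg_def path_deg_single)

lemma const_deg_nth: "x \<in> const_deg n \<Longrightarrow> x 0 \<in> L n"
  by (auto simp: const_deg_def)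

lemma subsp_const_deg: "subsp (sc_fun sc) (const_deg n)"
  unfolding subsp_def const_deg_def
proof (intro conjI ballI allI)
  show "0 \<in> single 0 ` L n" by (rule image_eqI[of _ _ 0]) auto
  fix x assume "x \<in> single 0 ` L n"
  then obtain a where a: "a \<in> L n" "x = single 0 a" by blast
  show "sc_fun sc c x \<in> single 0 ` L n" for c
    using a by (auto simp: sc_fun_single[OF vs] G_scale)
  fix y assume "y \<in> single 0 ` L n"
  then obtain b where "b \<in> L n" "y = single 0 b" by blast
  then show "x + y \<in> single 0 ` L n"
    using a by (auto simp: G_add simp flip: single_add)
qed

lemma graded_const: "graded_space (sc_fun sc) const_deg"
  using graded_path vsf subsp_const_deg const_deg_path_deg unfolding graded_space_def by meson

lemma single_in_const_deg: "a \<in> L n \<Longrightarrow> single 0 a \<in> const_deg n"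
  by (simp add: const_deg_def)

lemma dgla_const: "dgla (sc_fun sc) const_deg (const_br c) const_d"
  unfolding dgla_def lin_on_def hom_map_def
proof (intro conjI allI impI ballI graded_const)
  fix m n x y z assume x: "x \<in> const_deg m" and y: "y \<in> const_deg n"
  note x' = const_deg_nth[OF x] and y' = const_deg_nth[OF y]
  show "const_br c x y \<in> const_deg (m + n)"
    using br_degree[OF x' y'] by (simp add: const_br_def single_in_const_deg G_scale)
  show "const_br c x y = - sgnp (m * n) (const_br c y x)"
    by (simp add: const_br_def br_anti[OF x' y'] single_uminus sgnp_scale
        flip: single_sgnp)
  show "const_br c x (const_br c y z) =
      const_br c (const_br c x y) z + sgnp (m * n) (const_br c y (const_br c x z))"
    by (simp add: const_br_def bilin br_jacobi[OF x' y'] scale_right_distrib sgnp_scale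
        flip: single_sgnp single_add)
next
  fix m x y assume x: "x \<in> const_deg m"
  note x' = const_deg_nth[OF x]
  show "const_d x \<in> const_deg (m + 1)"
    using d_degree[OF x'] by (simp add: const_d_def single_in_const_deg)
  show "const_d (const_br c x y) = const_br c (const_d x) y + sgnp m (const_br c x (const_d y))"
    by (simp add: const_br_def const_d_def bilin d_br[OF x'] scale_right_distrib sgnp_scale
        flip: single_sgnp single_add)
qed (simp_all add: const_br_def const_d_def bilin scale_right_distrib single_add
    sc_fun_single[OF vs] sc_fun_apply mult.commute)

lemma zero_exact: "0 \<in> const_d ` const_deg n"
  by (rule image_eqI[of _ _ 0]) (use subsp_const_deg in \<open>simp_all add: const_d_def subsp_def\<close>)

text \<open>In effect an isomorphism onto a copy of the DGLA inside \<open>nat => 'w\<close>, where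
  the rest of the zigzag has to live.\<close>

lemma single_qiso: "dgla_qiso sc L br d (sc_fun sc) const_deg (const_br 1) const_d (single 0)"
  unfolding dgla_qiso_def dgla_morphism_def hom_map_def
proof (intro conjI allI impI ballI dgla dgla_const)
  fix n x assume "x \<in> L n" and "single 0 x \<in> const_d ` const_deg (n - 1)"
  then show "x \<in> d ` L (n - 1)"
    by (auto simp: const_d_def const_deg_def dest: arg_cong[where f = "\<lambda>f. f 0"])
next
  fix n y assume y: "y \<in> const_deg n" and "const_d y = 0"
  then obtain a where a: "a \<in> L n" "y = single 0 a" by (auto simp: const_deg_def)
  have "d a = 0"
    using arg_cong[OF \<open>const_d y = 0\<close>, of "\<lambda>f. f 0"] by (simp add: a const_d_def)
  moreover have "0 \<in> const_d ` const_deg (n - 1)"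
    by (rule zero_exact)
  ultimately show "\<exists>x\<in>L n. d x = 0 \<and> y - single 0 x \<in> const_d ` const_deg (n - 1)"
    using a by (intro bexI[of _ a]) simp_all
qed (simp_all add: const_br_def const_d_def single_in_const_deg single_add sc_fun_single[OF vs])

text \<open>Evaluation at \<open>t = c\<close>, and the homotopy \<open>dt a \<mapsto> \<integral>\<^sub>c\<^sup>t a\<close> which makes it a quasi-isomorphism.\<close>

definition path_ev_gen :: "'k \<Rightarrow> nat \<Rightarrow> 'w \<Rightarrow> nat \<Rightarrow> 'w" where
  "path_ev_gen c j a = (if even j then single 0 (sc (c ^ (j div 2)) a) else 0)"

definition path_ev :: "'k \<Rightarrow> (nat \<Rightarrow> 'w) \<Rightarrow> nat \<Rightarrow> 'w" where
  "path_ev c x = extend (path_ev_gen c) x"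

definition path_int_gen :: "'k \<Rightarrow> nat \<Rightarrow> 'w \<Rightarrow> nat \<Rightarrow> 'w" where
  "path_int_gen c j a = (if odd j then
     single (j + 1) (sc (1 / of_nat (j div 2 + 1)) a)
     - single 0 (sc (c ^ (j div 2 + 1) / of_nat (j div 2 + 1)) a) else 0)"

definition path_int :: "'k \<Rightarrow> (nat \<Rightarrow> 'w) \<Rightarrow> nat \<Rightarrow> 'w" where
  "path_int c x = extend (path_int_gen c) x"

lemma path_ev_gen_0 [simp]: "path_ev_gen c j 0 = 0"
  by (simp add: path_ev_gen_def)

lemma path_int_gen_0 [simp]: "path_int_gen c j 0 = 0"
  by (simp add: path_int_gen_def)

lemma path_ev_single: "path_ev c (single j a) = path_ev_gen c j a"
  by (simp add: path_ev_def extend_single)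

lemma path_int_single: "path_int c (single j a) = path_int_gen c j a"
  by (simp add: path_int_def extend_single)

lemma path_ev_add: "finsupp x \<Longrightarrow> finsupp y \<Longrightarrow> path_ev c (x + y) = path_ev c x + path_ev c y"
  unfolding path_ev_def
  by (rule extend_add) (simp_all add: path_ev_gen_def scale_right_distrib single_add)

lemma path_int_add: "finsupp x \<Longrightarrow> finsupp y \<Longrightarrow> path_int c (x + y) = path_int c x + path_int c y"
  unfolding path_int_def
  by (rule extend_add) (simp_all add: path_int_gen_def scale_right_distrib single_add algebra_simps)

lemma path_ev_gen_scale: "path_ev_gen c j (sc e a) = sc_fun sc e (path_ev_gen c j a)"
  by (simp add: path_ev_gen_def sc_fun_single[OF vs] vs mult.commute)

lemma path_ev_scale: "finsupp x \<Longrightarrow> path_ev c (sc_fun sc e x) = sc_fun sc e (path_ev c x)"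
  unfolding path_ev_def by (rule extend_scale[OF vs path_ev_gen_scale path_ev_gen_0 vsf])

lemma path_int_gen_scale: "path_int_gen c j (sc e a) = sc_fun sc e (path_int_gen c j a)"
  by (simp add: path_int_gen_def F.scale_right_diff_distrib sc_fun_single[OF vs] vs mult.commute)

lemma path_int_scale: "finsupp x \<Longrightarrow> path_int c (sc_fun sc e x) = sc_fun sc e (path_int c x)"
  unfolding path_int_def by (rule extend_scale[OF vs path_int_gen_scale path_int_gen_0 vsf])

lemma path_ev_0 [simp]: "path_ev c 0 = 0"
  by (simp add: path_ev_def)

lemma path_int_0 [simp]: "path_int c 0 = 0"
  by (simp add: path_int_def)

lemma path_ev_uminus: "finsupp x \<Longrightarrow> path_ev c (- x) = - path_ev c x"
  using path_ev_scale[of x c "-1"] by simp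

lemma path_int_uminus: "finsupp x \<Longrightarrow> path_int c (- x) = - path_int c x"
  using path_int_scale[of x c "-1"] by simp

lemma path_ev_diff: "finsupp x \<Longrightarrow> finsupp y \<Longrightarrow> path_ev c (x - y) = path_ev c x - path_ev c y"
  using path_ev_add[of x "- y"] by (simp add: path_ev_uminus)

lemma finsupp_path_int [simp]: "finsupp (path_int c x)"
  unfolding path_int_def by (intro finsupp_extend) (simp add: path_int_gen_def)

lemma path_ev_degree: "x \<in> path_deg n \<Longrightarrow> path_ev c x \<in> const_deg n"
  unfolding path_ev_def
proof (rule extend_in[OF subsp_const_deg])
  fix j assume "x \<in> path_deg n"
  from path_deg_nth[OF this, of j] show "path_ev_gen c j (x j) \<in> const_deg n"
    using subsp_const_deg
    by (auto simp: path_ev_gen_def single_in_const_deg G_scale subsp_def)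
qed

lemma path_int_degree: "x \<in> path_deg n \<Longrightarrow> path_int c x \<in> path_deg (n - 1)"
  unfolding path_int_def
proof (rule extend_in[OF subsp_path_deg])
  fix j assume "x \<in> path_deg n"
  from path_deg_nth[OF this, of j] show "path_int_gen c j (x j) \<in> path_deg (n - 1)"
    by (auto simp: path_int_gen_def mod2_eq_if G_scale path_deg_closed(3)
        intro!: path_deg_diff path_deg_single)
qed

lemma const_d_add: "const_d (x + y) = const_d x + const_d y"
  by (simp add: const_d_def d_add single_add)

lemma path_ev_d: "finsupp x \<Longrightarrow> path_ev c (path_d x) = const_d (path_ev c x)"
proof (rule finsupp_induct[where P = "\<lambda>x. path_ev c (path_d x) = const_d (path_ev c x)"])
  fix j
  have "path_ev c (single (j - 1) (sc (of_nat (j div 2)) (x j))) = 0" if "even j"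
    using that by (cases j) (simp_all add: path_ev_single path_ev_gen_def)
  then show "path_ev c (path_d (single j (x j))) = const_d (path_ev c (single j (x j)))"
    by (cases "even j") (simp_all add: path_d_single path_d_gen_def path_ev_add path_ev_uminus
        path_ev_single path_ev_gen_def const_d_def d_scale)
qed (simp_all add: path_bilin path_ev_add const_d_add, simp add: const_d_def)

lemma const_br_add: "const_br c (x + x') y = const_br c x y + const_br c x' y"
   "const_br c x (y + y') = const_br c x y + const_br c x y'"
  by (simp_all add: const_br_def bilin single_add scale_right_distrib)

lemma path_ev_br:
  assumes "finsupp x" "finsupp y"
  shows "path_ev c (path_br x y) = const_br c (path_ev c x) (path_ev c y)"
proof (rule finsupp_induct[where P = "\<lambda>x. path_ev c (path_br x y) =
    const_br c (path_ev c x) (path_ev c y)", OF assms(1)])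
  fix i
  let ?x = "single i (x i)"
  show "path_ev c (path_br ?x y) = const_br c (path_ev c ?x) (path_ev c y)"
  proof (rule finsupp_induct[where P = "\<lambda>y. path_ev c (path_br ?x y) =
      const_br c (path_ev c ?x) (path_ev c y)", OF assms(2)])
    fix j
    have "even i \<Longrightarrow> even j \<Longrightarrow> (i + j) div 2 = i div 2 + j div 2" by auto
    then show "path_ev c (path_br ?x (single j (y j))) =
        const_br c (path_ev c ?x) (path_ev c (single j (y j)))"
      by (cases "even i"; cases "even j")
       (simp_all add: path_br_single path_br_gen_def path_ev_diff path_ev_single path_ev_gen_def
        const_br_def bilin power_add mult_ac)
  qed (simp_all add: path_bilin path_ev_add const_br_add, simp add: const_br_def)
qed (simp_all add: assms path_bilin path_ev_add const_br_add, simp add: const_br_def)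

text \<open>The fundamental theorem of calculus: the lower limit \<open>c\<close> of the integral
  produces the evaluation at \<open>c\<close>. The terms that apply \<open>d\<close> to coefficients
  cancel because \<open>path_d\<close> takes the opposite sign behind \<open>dt\<close>.\<close>

lemma path_int_homotopy:
  assumes "finsupp x"
  shows "path_d (path_int c x) + path_int c (path_d x) = x - path_ev c x"
proof (rule finsupp_induct[where P = "\<lambda>x. path_d (path_int c x) + path_int c (path_d x) = x - path_ev c x", OF assms])
  fix j
  have nz: "1 + of_nat n \<noteq> (0 :: 'k)" for n
    using of_nat_neq_0[of n, where 'a = 'k] by simp
  show "path_d (path_int c (single j (x j))) + path_int c (path_d (single j (x j))) =
      single j (x j) - path_ev c (single j (x j))"
  proof (cases "even j")
    case False
    then show ?thesis
      by (simp add: path_bilin path_d_gen_def path_int_single path_int_gen_def path_int_uminus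
          path_ev_single path_ev_gen_def d_scale nz)
  next
    case True
    show ?thesis
    proof (cases j)
      case 0
      then show ?thesis
        by (simp add: path_bilin path_d_gen_def path_int_single path_int_gen_def
            path_ev_single path_ev_gen_def)
    next
      case (Suc l)
      then have "odd l" using True by simp
      then show ?thesis
        using Suc by (simp add: path_bilin path_d_gen_def path_int_single path_int_gen_def path_int_add
            path_ev_single path_ev_gen_def nz)
    qed
  qed
next
  fix x y assume fin: "finsupp x" "finsupp y"
    and x: "path_d (path_int c x) + path_int c (path_d x) = x - path_ev c x"
    and y: "path_d (path_int c y) + path_int c (path_d y) = y - path_ev c y"
  have "path_d (path_int c (x + y)) + path_int c (path_d (x + y)) =
      (path_d (path_int c x) + path_int c (path_d x)) + (path_d (path_int c y) + path_int c (path_d y))"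
    using fin by (simp add: path_bilin path_int_add add_ac)
  also have "\<dots> = x + y - path_ev c (x + y)"
    unfolding x y using fin by (simp add: path_ev_add)
  finally show "path_d (path_int c (x + y)) + path_int c (path_d (x + y)) = x + y - path_ev c (x + y)" .
qed simp

text \<open>By the homotopy, a closed \<open>x\<close> with value \<open>d a\<close> is the
  differential of its integral plus the constant \<open>a\<close>. Constants are a section of the
  evaluation, which gives surjectivity on cohomology.\<close>

lemma path_ev_qiso:
  "dgla_qiso (sc_fun sc) path_deg path_br path_d (sc_fun sc) const_deg (const_br c) const_d (path_ev c)"
  unfolding dgla_qiso_def dgla_morphism_def hom_map_def
proof (intro conjI allI impI ballI dgla_path dgla_const)
  fix n x assume x: "x \<in> path_deg n" and dx: "path_d x = 0"
    and "path_ev c x \<in> const_d ` const_deg (n - 1)"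
  then obtain a where a: "a \<in> L (n - 1)" "path_ev c x = single 0 (d a)"
    by (auto simp: const_deg_def const_d_def)
  have "x = path_d (path_int c x) + path_ev c x"
    using path_int_homotopy[OF path_deg_finsupp[OF x], of c] dx by (simp add: algebra_simps)
  also have "\<dots> = path_d (path_int c x + single 0 a)"
    by (simp add: a path_bilin path_d_gen_def)
  finally have eq: "x = path_d (path_int c x + single 0 a)" .
  show "x \<in> path_d ` path_deg (n - 1)"
    by (subst eq, intro imageI path_deg_closed(1)[OF path_int_degree[OF x] path_deg_single])
      (simp add: a)
next
  fix n y assume y: "y \<in> const_deg n" and "const_d y = 0"
  then obtain a where a: "a \<in> L n" "y = single 0 a" by (auto simp: const_deg_def)
  have "d a = 0"
    using arg_cong[OF \<open>const_d y = 0\<close>, of "\<lambda>f. f 0"] by (simp add: a const_d_def)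
  then have "path_d y = 0"
    by (simp add: a path_d_single path_d_gen_def)
  moreover have "path_ev c y = y"
    by (simp add: a path_ev_single path_ev_gen_def)
  moreover have "0 \<in> const_d ` const_deg (n - 1)"
    by (rule zero_exact)
  ultimately show "\<exists>x\<in>path_deg n. path_d x = 0 \<and> y - path_ev c x \<in> const_d ` const_deg (n - 1)"
    using const_deg_path_deg[OF y] by (intro bexI[of _ y]) simp_all
qed (simp_all add: path_ev_degree path_ev_add path_ev_scale path_ev_d path_ev_br gcarrier_path_finsupp)

theorem homotopy_abelian: "homotopy_abelian sc L br d"
proof -
  have eq: "const_br 0 = (\<lambda>_ _. 0)"
    by (simp add: const_br_def fun_eq_iff)
  note ab = dgla_const[of 0, unfolded eq] and q0 = path_ev_qiso[of 0, unfolded eq]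
  have "qi_step (sc_fun sc) (const_deg, const_br 1, const_d) (path_deg, path_br, path_d)"
    unfolding qi_step_def using path_ev_qiso[of 1] by blast
  moreover have "qi_step (sc_fun sc) (path_deg, path_br, path_d) (const_deg, (\<lambda>_ _. 0), const_d)"
    unfolding qi_step_def using q0 by blast
  ultimately have "(qi_step (sc_fun sc))\<^sup>*\<^sup>* (const_deg, const_br 1, const_d) (const_deg, (\<lambda>_ _. 0), const_d)"
    by (meson converse_rtranclp_into_rtranclp r_into_rtranclp)
  then show ?thesis
    unfolding homotopy_abelian_def using dgla single_qiso ab by blast
qed

end

section \<open>Differential operators of order two\<close>

text \<open>The symbol Phi of \<open>f\<close>. The degrees \<open>p\<close> of \<open>f\<close> and
  \<open>n\<close> of \<open>a\<close> are parameters because an element need not determine its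
  degree: zero lies in every \<open>G n\<close>.\<close>

definition koszul2 :: "int \<Rightarrow> int \<Rightarrow> ('v::ring_1 \<Rightarrow> 'v) \<Rightarrow> 'v \<Rightarrow> 'v \<Rightarrow> 'v" where
  "koszul2 p n f a b = f (a * b) - f a * b - sgnp (p * n) (a * f b)"

locale graded_comm_algebra = total_graded_space sc G
  for sc :: "'k::field \<Rightarrow> 'v::ring_1 \<Rightarrow> 'v" and G :: "int \<Rightarrow> 'v set" +
  assumes scale_mult_left: "sc c x * y = sc c (x * y)"
    and scale_mult_right: "x * sc c y = sc c (x * y)"
    and one_degree: "1 \<in> G 0"
    and mult_degree: "x \<in> G m \<Longrightarrow> y \<in> G n \<Longrightarrow> x * y \<in> G (m + n)"
    and mult_comm: "x \<in> G m \<Longrightarrow> y \<in> G n \<Longrightarrow> x * y = sgnp (m * n) (y * x)"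
begin

abbreviation endo :: "int \<Rightarrow> ('v \<Rightarrow> 'v) \<Rightarrow> bool" where
  "endo \<equiv> hom_map sc G sc G"

lemma endoI:
  assumes "\<And>n x. x \<in> G n \<Longrightarrow> f x \<in> G (n + p)" "\<And>x y. f (x + y) = f x + f y"
    "\<And>c x. f (sc c x) = sc c (f x)"
  shows "endo p f"
  using assms by (simp add: hom_map_def)

lemma endo_degree: "endo p f \<Longrightarrow> x \<in> G n \<Longrightarrow> f x \<in> G (n + p)"
  by (simp add: hom_map_def)
lemma endo_add: "endo p f \<Longrightarrow> f (x + y) = f x + f y"
  by (simp add: hom_map_def total)
lemma endo_scale: "endo p f \<Longrightarrow> f (sc c x) = sc c (f x)"
  by (simp add: hom_map_def total)
lemma endo_0: "endo p f \<Longrightarrow> f 0 = 0"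
  using endo_scale[of p f 0] by simp
lemma endo_uminus: "endo p f \<Longrightarrow> f (- x) = - f x"
  using endo_scale[of p f "-1"] by simp
lemma endo_diff: "endo p f \<Longrightarrow> f (x - y) = f x - f y"
  using endo_add[of p f x "- y"] by (simp add: endo_uminus)

lemmas endo_lin = endo_add endo_uminus endo_diff

lemma endo_koszul2:
  assumes f: "endo p f" and a: "a \<in> G n"
  shows "endo (p + n) (koszul2 p n f a)"
proof (rule endoI)
  fix m x assume x: "x \<in> G m"
  have "f (a * x) \<in> G (m + (p + n))" "f a * x \<in> G (m + (p + n))" "a * f x \<in> G (m + (p + n))"
    using endo_degree[OF f mult_degree[OF a x]] mult_degree[OF endo_degree[OF f a] x]
      mult_degree[OF a endo_degree[OF f x]] by (simp_all add: ac_simps)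
  then show "koszul2 p n f a x \<in> G (m + (p + n))"
    by (simp add: koszul2_def G_diff G_sgnp)
qed (simp_all add: koszul2_def endo_add[OF f] endo_scale[OF f] sgnp_add sgnp_scale algebra_simps
    scale_mult_left scale_mult_right scale_right_diff_distrib scale_right_distrib)

definition deriv :: "int \<Rightarrow> ('v \<Rightarrow> 'v) \<Rightarrow> bool" where
  "deriv p D \<longleftrightarrow> endo p D \<and>
     (\<forall>m x y. x \<in> G m \<longrightarrow> D (x * y) = D x * y + sgnp (p * m) (x * D y))"

lemma deriv_endo: "deriv p D \<Longrightarrow> endo p D"
  and deriv_mult: "deriv p D \<Longrightarrow> x \<in> G m \<Longrightarrow> D (x * y) = D x * y + sgnp (p * m) (x * D y)"
  by (simp_all add: deriv_def)

lemma derivI: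
  assumes D: "endo p D"
    and hom: "\<And>m n x y. x \<in> G m \<Longrightarrow> y \<in> G n \<Longrightarrow> D (x * y) = D x * y + sgnp (p * m) (x * D y)"
  shows "deriv p D"
  unfolding deriv_def
proof (intro conjI allI impI D)
  fix m x y assume x: "x \<in> G m"
  show "D (x * y) = D x * y + sgnp (p * m) (x * D y)"
    by (rule homogeneous_induct[of _ y])
      (simp_all add: endo_0[OF D] hom[OF x] endo_add[OF D] distrib_left sgnp_add)
qed

section \<open>Order two expressed through the symbol\<close>

definition order2 :: "int \<Rightarrow> ('v \<Rightarrow> 'v) \<Rightarrow> bool" where
  "order2 p f \<longleftrightarrow> endo p f \<and> f 1 = 0 \<and> (\<forall>n a. a \<in> G n \<longrightarrow> deriv (p + n) (koszul2 p n f a))"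

text \<open>\<open>[f,a]\<close> is the sum of Phi(a,-) and the multiplication by
  \<open>f a\<close>; the latter graded-commutes with the multiplication by \<open>b\<close> and
  drops out.\<close>

lemma gcomm_gcomm_lmul:
  assumes f: "endo p f" and a: "a \<in> G m" and b: "b \<in> G n"
  shows "gcomm (p + m) (gcomm p f m (lmul a)) n (lmul b) x =
    koszul2 p m f a (b * x) - sgnp ((p + m) * n) (b * koszul2 p m f a x)"
  using mult_comm[OF endo_degree[OF f a] b]
  by (cases "even p"; cases "even m"; cases "even n")
    (simp_all add: gcomm_def lmul_def koszul2_def sgnp_def algebra_simps flip: mult.assoc)

text \<open>Evaluating the triple commutator at 1, where Phi(a,1) = 0 because
  \<open>f 1 = 0\<close>, yields the Leibniz rule for Phi(a,-). Conversely, if Phi(a,-) is a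
  derivation, then \<open>[[f,a],b]\<close> is multiplication by Phi(a,b), which graded-commutes
  with \<open>c\<close>.\<close>

lemma quasi_BV_iff_order2: "quasi_BV sc G p f \<longleftrightarrow> order2 p f"
proof
  assume f: "quasi_BV sc G p f"
  then have endo: "endo p f" and f1: "f 1 = 0" by (simp_all add: quasi_BV_def)
  have "deriv (p + m) (koszul2 p m f a)" if a: "a \<in> G m" for m a
  proof (rule derivI[OF endo_koszul2[OF endo a]])
    fix n l b c assume b: "b \<in> G n" and c: "c \<in> G l"
    let ?K = "koszul2 p m f a"
    have K1: "?K 1 = 0" by (simp add: koszul2_def f1)
    have "gcomm (p + m + n) (gcomm (p + m) (gcomm p f m (lmul a)) n (lmul b)) l (lmul c) 1 = 0"
      using f a b c by (auto simp: quasi_BV_def)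
    then have "?K (b * c) - sgnp ((p + m) * n) (b * ?K c) = sgnp ((p + m + n) * l) (c * ?K b)"
      unfolding gcomm_def[of "p + m + n"] lmul_def[of c] gcomm_gcomm_lmul[OF endo a b]
      by (simp add: K1)
    moreover have "?K b * c = sgnp ((p + m + n) * l) (c * ?K b)"
      using mult_comm[OF endo_degree[OF endo_koszul2[OF endo a] b] c] by (simp add: ac_simps)
    ultimately show "?K (b * c) = ?K b * c + sgnp ((p + m) * n) (b * ?K c)"
      by (simp add: algebra_simps)
  qed
  then show "order2 p f" using endo f1 by (simp add: order2_def)
next
  assume f: "order2 p f"
  then have endo: "endo p f" and f1: "f 1 = 0" by (simp_all add: order2_def)
  have "gcomm (p + m + n) (gcomm (p + m) (gcomm p f m (lmul a)) n (lmul b)) l (lmul c) = (\<lambda>_. 0)"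
    if a: "a \<in> G m" and b: "b \<in> G n" and c: "c \<in> G l" for m n l a b c
  proof
    fix x
    let ?K = "koszul2 p m f a"
    have D: "deriv (p + m) ?K" using f a by (simp add: order2_def)
    have "?K b * c = sgnp ((p + m + n) * l) (c * ?K b)"
      using mult_comm[OF endo_degree[OF endo_koszul2[OF endo a] b] c] by (simp add: ac_simps)
    then show "gcomm (p + m + n) (gcomm (p + m) (gcomm p f m (lmul a)) n (lmul b)) l (lmul c) x = 0"
      unfolding gcomm_def[of "p + m + n"] lmul_def[of c] gcomm_gcomm_lmul[OF endo a b] deriv_mult[OF D b]
      by (simp add: sgnp_def flip: mult.assoc)
  qed
  then show "quasi_BV sc G p f" using endo f1 by (simp add: quasi_BV_def)
qed

section \<open>Symbols of commutators\<close>

lemma endo_gcomm: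
  assumes f: "endo p f" and g: "endo q g"
  shows "endo (p + q) (gcomm p f q g)"
proof (rule endoI)
  fix n x assume x: "x \<in> G n"
  show "gcomm p f q g x \<in> G (n + (p + q))"
    using endo_degree[OF f endo_degree[OF g x]] endo_degree[OF g endo_degree[OF f x]]
    by (simp add: gcomm_def G_diff G_sgnp ac_simps)
qed (simp_all add: gcomm_def endo_add[OF f] endo_add[OF g] endo_scale[OF f] endo_scale[OF g]
    sgnp_add sgnp_scale scale_right_diff_distrib)

text \<open>A derivation has zero symbol, so the symbol of \<open>[f,D]\<close> is the commutator of
  the symbol of \<open>f\<close> with \<open>D\<close>. For \<open>f = i\<close> and
  \<open>D = d\<close> this exhibits the bracket as a boundary; with a partially applied symbol as
  \<open>D\<close> it leads to the Jacobi-type identities.\<close>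

lemma koszul2_gcomm_deriv:
  assumes f: "endo p f" and D: "deriv r D" and b: "b \<in> G n"
  shows "koszul2 (p + r) n (gcomm p f r D) b c =
    koszul2 p (r + n) f (D b) c + sgnp (r * n) (koszul2 p n f b (D c))
    - sgnp (p * r) (D (koszul2 p n f b c))"
proof -
  note D' = deriv_endo[OF D]
  show ?thesis
    by (cases "even p"; cases "even r"; cases "even n")
      (simp_all add: koszul2_def gcomm_def sgnp_def endo_lin[OF f] endo_lin[OF D']
        deriv_mult[OF D b] deriv_mult[OF D endo_degree[OF f b]] algebra_simps)
qed

lemma deriv_gcomm:
  assumes D: "deriv p D" and E: "deriv q E"
  shows "deriv (p + q) (gcomm p D q E)"
proof (rule derivI)
  note D' = deriv_endo[OF D] and E' = deriv_endo[OF E]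
  show "endo (p + q) (gcomm p D q E)" by (rule endo_gcomm[OF D' E'])
  fix m n x y assume x: "x \<in> G m"
  show "gcomm p D q E (x * y) = gcomm p D q E x * y + sgnp ((p + q) * m) (x * gcomm p D q E y)"
    by (cases "even p"; cases "even q"; cases "even m")
      (simp_all add: gcomm_def sgnp_def endo_lin[OF D'] endo_lin[OF E'] deriv_mult[OF D x]
        deriv_mult[OF E x] deriv_mult[OF D endo_degree[OF E' x]] deriv_mult[OF E endo_degree[OF D' x]]
        algebra_simps)
qed

lemma deriv_cong: "deriv p D \<Longrightarrow> (\<And>x. D x = E x) \<Longrightarrow> deriv p E"
  by (metis ext)

lemma deriv_add:
  assumes D: "deriv p D" and E: "deriv p E"
  shows "deriv p (\<lambda>x. D x + E x)"
proof (rule derivI)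
  note D' = deriv_endo[OF D] and E' = deriv_endo[OF E]
  show "endo p (\<lambda>x. D x + E x)"
    by (rule endoI) (simp_all add: endo_degree[OF D'] endo_degree[OF E'] G_add endo_add[OF D'] endo_add[OF E']
      endo_scale[OF D'] endo_scale[OF E'] scale_right_distrib)
qed (simp add: deriv_mult[OF D] deriv_mult[OF E] sgnp_add algebra_simps)

lemma deriv_sgnp:
  assumes D: "deriv p D"
  shows "deriv p (\<lambda>x. sgnp n (D x))"
proof (rule derivI)
  note D' = deriv_endo[OF D]
  show "endo p (\<lambda>x. sgnp n (D x))"
    by (rule endoI) (simp_all add: endo_degree[OF D'] G_sgnp endo_add[OF D']
      endo_scale[OF D'] sgnp_scale sgnp_add)
qed (simp add: deriv_mult[OF D] sgnp_def algebra_simps)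

text \<open>With first argument \<open>a\<close> fixed, the symbol of \<open>[f,D]\<close> is a
  signed sum of two derivations: the symbol of \<open>f\<close> at \<open>D a\<close>, and the
  commutator of \<open>D\<close> with the symbol of \<open>f\<close> at \<open>a\<close>. Thus order
  two passes from \<open>i\<close> to \<open>l\<close>, and from \<open>[l,i]\<close> to
  \<open>[l,l]\<close>.\<close>

lemma order2_gcomm_deriv:
  assumes f: "order2 p f" and D: "deriv r D"
  shows "order2 (p + r) (gcomm p f r D)"
  unfolding order2_def
proof (intro conjI allI impI)
  have endo: "endo p f" and f1: "f 1 = 0"
    and K: "\<And>n a. a \<in> G n \<Longrightarrow> deriv (p + n) (koszul2 p n f a)"
    using f by (simp_all add: order2_def)
  note D' = deriv_endo[OF D]
  show "endo (p + r) (gcomm p f r D)" by (rule endo_gcomm[OF endo D'])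
  have "D 1 = 0" using deriv_mult[OF D one_degree, of 1] by (simp add: sgnp_def)
  then show "gcomm p f r D 1 = 0"
    by (simp add: gcomm_def f1 endo_0[OF endo] endo_0[OF D'])
  fix n a assume a: "a \<in> G n"
  have "deriv (p + (n + r)) (koszul2 p (n + r) f (D a))"
    by (rule K[OF endo_degree[OF D' a]])
  moreover have "deriv (r + (p + n)) (gcomm r D (p + n) (koszul2 p n f a))"
    by (rule deriv_gcomm[OF D K[OF a]])
  ultimately have "deriv (p + r + n) (\<lambda>x. koszul2 p (n + r) f (D a) x +
      sgnp (p * r + 1) (gcomm r D (p + n) (koszul2 p n f a) x))"
    by (intro deriv_add deriv_sgnp) (simp_all add: ac_simps)
  then show "deriv (p + r + n) (koszul2 (p + r) n (gcomm p f r D) a)"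
  proof (rule deriv_cong)
    fix x
    show "koszul2 p (n + r) f (D a) x +
        sgnp (p * r + 1) (gcomm r D (p + n) (koszul2 p n f a) x) =
      koszul2 (p + r) n (gcomm p f r D) a x"
      by (subst koszul2_gcomm_deriv[OF endo D a]) (simp add: gcomm_def sgnp_def ac_simps algebra_simps)
  qed
qed

text \<open>The Jacobi identity for \<open>[[f,g],a]\<close>, with \<open>[f,a]\<close> and
  \<open>[g,a]\<close> split into symbol and multiplication. For \<open>f\<close> and
  \<open>g\<close> of order two the first two terms are derivations, so only the commutators with
  \<open>H\<close> and \<open>F\<close> can raise the order of \<open>[f,g]\<close>.\<close>

lemma koszul2_gcomm:
  assumes f: "endo p f" and g: "endo q g" and a: "a \<in> G n"
  defines "F \<equiv> koszul2 p n f a" and "H \<equiv> koszul2 q n g a"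
  shows "koszul2 (p + q) n (gcomm p f q g) a x =
    koszul2 p (q + n) f (g a) x - sgnp (p * q) (koszul2 q (p + n) g (f a) x)
    + (gcomm p f (q + n) H x - sgnp (p * q) (gcomm q g (p + n) F x))"
  unfolding F_def H_def
  by (cases "even p"; cases "even q"; cases "even n")
    (simp_all add: koszul2_def gcomm_def sgnp_def endo_lin[OF f] endo_lin[OF g] algebra_simps)

text \<open>By \<open>koszul2_gcomm\<close>, \<open>[f,H] \<mp> [g,F]\<close> is a derivation, so its symbol vanishes.\<close>

lemma koszul2_compose:
  assumes f: "order2 p f" and g: "order2 q g" and h: "order2 (p + q) (gcomm p f q g)"
    and a: "a \<in> G m" and b: "b \<in> G n"
  defines "F \<equiv> koszul2 p m f a" and "H \<equiv> koszul2 q m g a"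
  shows "koszul2 p (q + m + n) f (H b) c + sgnp ((q + m) * n) (koszul2 p n f b (H c))
      - sgnp (p * (q + m)) (H (koszul2 p n f b c)) =
    sgnp (p * q) (koszul2 q (p + m + n) g (F b) c + sgnp ((p + m) * n) (koszul2 q n g b (F c))
      - sgnp (q * (p + m)) (F (koszul2 q n g b c)))"
proof -
  have f': "endo p f" and g': "endo q g"
    using f g by (simp_all add: order2_def)
  have dF: "deriv (p + m) F" and dH: "deriv (q + m) H"
    using f g a by (simp_all add: F_def H_def order2_def)
  have "deriv (p + q + m) (koszul2 (p + q) m (gcomm p f q g) a)"
    using h a by (simp add: order2_def)
  moreover have "deriv (p + q + m) (koszul2 p (q + m) f (g a))"
    using f endo_degree[OF g' a] unfolding order2_def by (metis add.assoc add.commute)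
  moreover have "deriv (p + q + m) (koszul2 q (p + m) g (f a))"
    using g endo_degree[OF f' a] unfolding order2_def by (metis add.assoc add.commute)
  ultimately have "deriv (p + q + m) (\<lambda>x. koszul2 (p + q) m (gcomm p f q g) a x +
      sgnp 1 (koszul2 p (q + m) f (g a) x) + sgnp (p * q) (koszul2 q (p + m) g (f a) x))"
    by (intro deriv_add deriv_sgnp)
  then have X: "deriv (p + q + m) (\<lambda>x. gcomm p f (q + m) H x - sgnp (p * q) (gcomm q g (p + m) F x))"
    by (rule deriv_cong) (simp add: koszul2_gcomm[OF f' g' a] F_def H_def sgnp_def[of 1])
  \<comment> \<open>\<open>H\<close> and \<open>F\<close> are derivations by order two of
    \<open>g\<close> and \<open>f\<close>, so these symbols expand into commutators of
    symbols.\<close>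
  have fH: "koszul2 (p + (q + m)) n (gcomm p f (q + m) H) b c =
     koszul2 p (q + m + n) f (H b) c + sgnp ((q + m) * n) (koszul2 p n f b (H c))
      - sgnp (p * (q + m)) (H (koszul2 p n f b c))"
    by (rule koszul2_gcomm_deriv[OF f' dH b])
  have gF: "koszul2 (q + (p + m)) n (gcomm q g (p + m) F) b c =
     koszul2 q (p + m + n) g (F b) c + sgnp ((p + m) * n) (koszul2 q n g b (F c))
      - sgnp (q * (p + m)) (F (koszul2 q n g b c))"
    by (rule koszul2_gcomm_deriv[OF g' dF b])
  \<comment> \<open>The Leibniz rule for the derivation \<open>X\<close> equates the two symbols up
    to sign.\<close>
  have "koszul2 (p + (q + m)) n (gcomm p f (q + m) H) b c =
      sgnp (p * q) (koszul2 (q + (p + m)) n (gcomm q g (p + m) F) b c)"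
    using deriv_mult[OF X b, of c] unfolding koszul2_def
    by (cases "even p"; cases "even q"; cases "even m"; cases "even n")
      (simp_all add: sgnp_def algebra_simps)
  then show ?thesis unfolding fH gF .
qed

section \<open>The bracket as a signed symbol\<close>

lemma brl_eq:
  assumes l: "endo p l"
  shows "brl G l a b = l (grading_inv G a * b) - l (grading_inv G a) * b - a * l b"
proof -
  have ls: "l (sum h S) = (\<Sum>x\<in>S. l (h x))" for h and S :: "int set"
    by (induction S rule: infinite_finite_induct) (simp_all add: endo_0[OF l] endo_add[OF l])
  have "(\<Sum>n\<in>{n. gcomp G n a \<noteq> 0}. sgnp n (l (gcomp G n a * b) - l (gcomp G n a) * b)) =
      l (grading_inv G a * b) - l (grading_inv G a) * b"
    unfolding grading_inv_def ls sum_distrib_right sum_subtractf[symmetric]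
    by (rule sum.cong) (auto simp: sgnp_def endo_uminus[OF l])
  then show ?thesis by (simp add: brl_def)
qed

text \<open>For odd \<open>p\<close> the signs (-1)^n and (-1)^(pn) cancel, which is why
  \<open>a * l b\<close> carries no sign in the bracket.\<close>

lemma brl_homogeneous:
  assumes l: "endo p l" and p: "odd p" and a: "a \<in> G n"
  shows "brl G l a b = sgnp n (koszul2 p n l a b)"
  using p by (simp add: brl_eq[OF l] grading_inv_homogeneous[OF a] koszul2_def sgnp_def endo_uminus[OF l])

end

section \<open>The bracket of a quasi-BV operator\<close>

locale quasi_BV_dgca = graded_comm_algebra sc G
  for sc :: "'k::field_char_0 \<Rightarrow> 'v::ring_1 \<Rightarrow> 'v" and G :: "int \<Rightarrow> 'v set" +
  fixes d i :: "'v \<Rightarrow> 'v" and k :: int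
  assumes dgca: "dgca sc G d"
    and i: "quasi_BV sc G (- 2 * k) i"
    and li: "quasi_BV sc G (1 - 4 * k) (gcomm (1 - 2 * k) (gcomm (- 2 * k) i 1 d) (- 2 * k) i)"
begin

definition l :: "'v \<Rightarrow> 'v" where
  "l = gcomm (- 2 * k) i 1 d"

abbreviation br :: "'v \<Rightarrow> 'v \<Rightarrow> 'v" where
  "br \<equiv> brl G l"

abbreviation Lg :: "int \<Rightarrow> 'v set" where
  "Lg \<equiv> shift G (2 * k - 1)"

text \<open>The symbol of \<open>i\<close> with the same factor (-1)^|a| by which \<open>br\<close>
  differs from the symbol of \<open>l\<close>.\<close>

definition q :: "'v \<Rightarrow> 'v \<Rightarrow> 'v" where
  "q a b = i (grading_inv G a * b) - i (grading_inv G a) * b - grading_inv G a * i b"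

lemma deriv_d: "deriv 1 d"
  using dgca by (simp add: deriv_def dgca_def)

lemma d_d: "d (d x) = 0"
  using dgca by (simp add: dgca_def)

lemma order2_i: "order2 (- 2 * k) i"
  using i by (simp only: quasi_BV_iff_order2)

lemma order2_l: "order2 (1 - 2 * k) l"
  using order2_gcomm_deriv[OF order2_i deriv_d, folded l_def] by (simp add: add.commute)

lemmas endo_d = deriv_endo[OF deriv_d]

lemma endo_i: "endo (- 2 * k) i"
  using order2_i by (simp add: order2_def)

lemma endo_l: "endo (1 - 2 * k) l"
  using order2_l unfolding order2_def by blast

lemma l_apply: "l x = i (d x) - d (i x)"
  by (simp add: l_def gcomm_def sgnp_def)

lemma d_l: "d (l x) = - l (d x)"
  by (simp add: l_apply d_d endo_diff[OF endo_d] endo_0[OF endo_i])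

lemma order2_li: "order2 ((1 - 2 * k) + (- 2 * k)) (gcomm (1 - 2 * k) l (- 2 * k) i)"
proof -
  have "(1 - 2 * k) + (- 2 * k) = 1 - 4 * k" by simp
  then show ?thesis using li by (simp only: quasi_BV_iff_order2 l_def)
qed

text \<open>Because \<open>[l,d] = 0\<close>, the Jacobi identity for commutators reduces
  \<open>[[l,i],d]\<close> to \<open>[l,[i,d]]\<close>, and commuting with the derivation
  \<open>d\<close> preserves order two.\<close>

lemma order2_ll: "order2 ((1 - 2 * k) + (1 - 2 * k)) (gcomm (1 - 2 * k) l (1 - 2 * k) l)"
proof -
  have "gcomm ((1 - 2 * k) + (- 2 * k)) (gcomm (1 - 2 * k) l (- 2 * k) i) 1 d =
      gcomm (1 - 2 * k) l (1 - 2 * k) l"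
    by (rule ext)
      (simp add: gcomm_def l_apply sgnp_def d_d endo_lin[OF endo_d] endo_0[OF endo_d]
        endo_lin[OF endo_i] endo_0[OF endo_i])
  moreover have "(1 - 2 * k) + (- 2 * k) + 1 = (1 - 2 * k) + (1 - 2 * k)" by simp
  ultimately show ?thesis
    using order2_gcomm_deriv[OF order2_li deriv_d] by metis
qed

lemma br_koszul2: "a \<in> G n \<Longrightarrow> br a b = sgnp n (koszul2 (1 - 2 * k) n l a b)"
  by (rule brl_homogeneous[OF endo_l]) simp

lemma q_koszul2: "a \<in> G n \<Longrightarrow> q a b = sgnp n (koszul2 (- 2 * k) n i a b)"
  by (simp add: q_def grading_inv_homogeneous koszul2_def sgnp_def endo_uminus[OF endo_i])

lemma koszul2_i_degree:
  "a \<in> G m \<Longrightarrow> b \<in> G n \<Longrightarrow> koszul2 (- 2 * k) m i a b \<in> G (m + n - 2 * k)"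
  using endo_degree[OF endo_koszul2[OF endo_i]] by (fastforce simp: algebra_simps)

lemma koszul2_l_degree:
  "a \<in> G m \<Longrightarrow> b \<in> G n \<Longrightarrow> koszul2 (1 - 2 * k) m l a b \<in> G (m + n + 1 - 2 * k)"
  using endo_degree[OF endo_koszul2[OF endo_l]] by (fastforce simp: algebra_simps)

lemma koszul2_sgnp_left: "endo p f \<Longrightarrow> koszul2 p n f (sgnp m a) b = sgnp m (koszul2 p n f a b)"
  and koszul2_sgnp_right: "endo p f \<Longrightarrow> koszul2 p n f a (sgnp m b) = sgnp m (koszul2 p n f a b)"
  by (simp_all add: koszul2_def sgnp_def endo_uminus)

lemmas koszul2_sgnp = koszul2_sgnp_left[OF endo_i] koszul2_sgnp_right[OF endo_i]
  koszul2_sgnp_left[OF endo_l] koszul2_sgnp_right[OF endo_l]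

lemma br_anti:
  assumes a: "a \<in> G m" and b: "b \<in> G n"
  shows "br a b = sgnp (m + n + m * n) (br b a)"
  using mult_comm[OF a b] mult_comm[OF a endo_degree[OF endo_l b]]
    mult_comm[OF b endo_degree[OF endo_l a]]
  unfolding br_koszul2[OF a] br_koszul2[OF b] koszul2_def
  by (cases "even m"; cases "even n") (simp_all add: sgnp_def endo_uminus[OF endo_l])

lemma q_anti:
  assumes a: "a \<in> G m" and b: "b \<in> G n"
  shows "q a b = sgnp (m + n + m * n) (q b a)"
  using mult_comm[OF a b] mult_comm[OF a endo_degree[OF endo_i b]]
    mult_comm[OF b endo_degree[OF endo_i a]]
  unfolding q_koszul2[OF a] q_koszul2[OF b] koszul2_def
  by (cases "even m"; cases "even n") (simp_all add: sgnp_def endo_uminus[OF endo_i])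

lemma br_eq_boundary:
  assumes a: "a \<in> G m"
  shows "br a b = - (d (q a b) + q (d a) b - sgnp m (q a (d b)))"
  using koszul2_gcomm_deriv[OF endo_i deriv_d a, of b, folded l_def]
  unfolding br_koszul2[OF a] q_koszul2[OF a] q_koszul2[OF endo_degree[OF endo_d a]]
  by (cases "even m") (simp_all add: sgnp_def endo_uminus[OF endo_d] add.commute)

lemma d_br:
  assumes a: "a \<in> G m"
  shows "d (br a b) = br (d a) b - sgnp m (br a (d b))"
proof -
  have "gcomm (1 - 2 * k) l 1 d = (\<lambda>_. 0)"
    by (rule ext) (simp add: gcomm_def[of "1 - 2 * k"] sgnp_def d_l)
  then have "koszul2 ((1 - 2 * k) + 1) m (gcomm (1 - 2 * k) l 1 d) a b = 0"
    by (simp add: koszul2_def)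
  from this[unfolded koszul2_gcomm_deriv[OF endo_l deriv_d a]] show ?thesis
    unfolding br_koszul2[OF a] br_koszul2[OF endo_degree[OF endo_d a]]
    by (cases "even m") (simp_all add: sgnp_def endo_uminus[OF endo_d] eq_neg_iff_add_eq_0 algebra_simps)
qed

text \<open>The outer sign depends on the degree of the inner value; the odd degree of
  \<open>l\<close> causes the minus sign, which is absent in \<open>br_q_left\<close> because
  \<open>i\<close> is even.\<close>

lemma br_br_left:
  assumes a: "a \<in> G m" and b: "b \<in> G n"
  shows "br (br a b) c = - sgnp n (koszul2 (1 - 2 * k) (1 - 2 * k + m + n) l (koszul2 (1 - 2 * k) m l a b) c)"
proof -
  have "br a b \<in> G (1 - 2 * k + m + n)"
    using koszul2_l_degree[OF a b] by (simp add: br_koszul2[OF a] G_sgnp algebra_simps)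
  from br_koszul2[OF this] show ?thesis
    by (simp add: br_koszul2[OF a] koszul2_sgnp) (simp add: sgnp_def)
qed

lemma br_q_left:
  assumes a: "a \<in> G m" and b: "b \<in> G n"
  shows "br (q a b) c = sgnp n (koszul2 (1 - 2 * k) (- 2 * k + m + n) l (koszul2 (- 2 * k) m i a b) c)"
proof -
  have "q a b \<in> G (- 2 * k + m + n)"
    using koszul2_i_degree[OF a b] by (simp add: q_koszul2[OF a] G_sgnp algebra_simps)
  from br_koszul2[OF this] show ?thesis
    by (simp only: q_koszul2[OF a] koszul2_sgnp) (simp add: sgnp_def)
qed

lemma q_br_left:
  assumes a: "a \<in> G m" and b: "b \<in> G n"
  shows "q (br a b) c = - sgnp n (koszul2 (- 2 * k) (1 - 2 * k + m + n) i (koszul2 (1 - 2 * k) m l a b) c)"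
proof -
  have "br a b \<in> G (1 - 2 * k + m + n)"
    using koszul2_l_degree[OF a b] by (simp add: br_koszul2[OF a] G_sgnp algebra_simps)
  from q_koszul2[OF this] show ?thesis
    by (simp only: br_koszul2[OF a] koszul2_sgnp) (simp add: sgnp_def)
qed

text \<open>\<open>T\<close> is the Jacobiator up to sign. Interchanging two copies of the odd
  operator \<open>l\<close> in \<open>koszul2_compose\<close> gives \<open>T = - T\<close>, and 2 is
  invertible.\<close>

lemma br_jacobi:
  assumes a: "a \<in> G m" and b: "b \<in> G n"
  shows "br a (br b c) = br (br a b) c + sgnp ((m + 1) * (n + 1)) (br b (br a c))"
proof -
  have two: "x = 0" if "x = - x" for x :: 'v
  proof -
    have "sc 2 x = sc (1 + 1) x" by simp
    also have "\<dots> = x + x" unfolding scale_left_distrib by simp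
    also have "\<dots> = 0" using that by (metis add.right_inverse)
    finally show ?thesis by simp
  qed
  define T where "T = koszul2 (1 - 2 * k) (1 - 2 * k + m + n) l (koszul2 (1 - 2 * k) m l a b) c
      + sgnp ((1 - 2 * k + m) * n) (koszul2 (1 - 2 * k) n l b (koszul2 (1 - 2 * k) m l a c))
      - sgnp ((1 - 2 * k) * (1 - 2 * k + m))
          (koszul2 (1 - 2 * k) m l a (koszul2 (1 - 2 * k) n l b c))"
  have "T = sgnp ((1 - 2 * k) * (1 - 2 * k)) T"
    using koszul2_compose[OF order2_l order2_l order2_ll a b, of c] by (simp only: T_def)
  then have "T = - T" by (simp add: sgnp_def)
  then have "T = 0" by (rule two)
  then show ?thesis
    unfolding br_br_left[OF a b] T_def unfolding br_koszul2[OF a] br_koszul2[OF b] koszul2_sgnp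
    by (cases "even m"; cases "even n") (simp_all add: sgnp_def eq_neg_iff_add_eq_0 algebra_simps)
qed

text \<open>The instance of \<open>koszul2_compose\<close> for the pair \<open>l\<close>,
  \<open>i\<close>; this is where the assumption on \<open>[l,i]\<close> itself, and not its
  consequence for \<open>[l,l]\<close>, is used.\<close>

lemma q_br:
  assumes a: "a \<in> G m" and b: "b \<in> G n"
  shows "q a (br b c) - sgnp m (br a (q b c)) =
    q (br a b) c + br (q a b) c + sgnp ((m + 1) * (n + 1)) (q b (br a c) - sgnp n (br b (q a c)))"
  using koszul2_compose[OF order2_l order2_i order2_li a b, of c]
  unfolding q_br_left[OF a b] br_q_left[OF a b]
  unfolding br_koszul2[OF a] br_koszul2[OF b] q_koszul2[OF a] q_koszul2[OF b] koszul2_sgnp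
  by (cases "even m"; cases "even n") (simp_all add: sgnp_def algebra_simps)

section \<open>The shifted algebra and the three conclusions\<close>

lemma total_shift: "total_graded_space sc Lg"
  by (rule total_graded_space_shift) unfold_locales

lemma br_add_left: "br (x + y) z = br x z + br y z"
  by (simp add: brl_eq[OF endo_l] grading_inv_add endo_add[OF endo_l] algebra_simps)
lemma br_add_right: "br x (y + z) = br x y + br x z"
  by (simp add: brl_eq[OF endo_l] endo_add[OF endo_l] algebra_simps)
lemma br_scale_left: "br (sc c x) y = sc c (br x y)"
  by (simp add: brl_eq[OF endo_l] grading_inv_scale endo_scale[OF endo_l] scale_mult_left
      scale_right_diff_distrib)
lemma br_scale_right: "br x (sc c y) = sc c (br x y)"
  by (simp add: brl_eq[OF endo_l] endo_scale[OF endo_l] scale_mult_right scale_right_diff_distrib)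
lemma q_add_left: "q (x + y) z = q x z + q y z"
  by (simp add: q_def grading_inv_add endo_add[OF endo_i] algebra_simps)
lemma q_add_right: "q x (y + z) = q x y + q x z"
  by (simp add: q_def endo_add[OF endo_i] algebra_simps)
lemma q_scale_left: "q (sc c x) y = sc c (q x y)"
  by (simp add: q_def grading_inv_scale endo_scale[OF endo_i] scale_mult_left
      scale_right_diff_distrib)
lemma q_scale_right: "q x (sc c y) = sc c (q x y)"
  by (simp add: q_def endo_scale[OF endo_i] scale_mult_right scale_right_diff_distrib)

lemma dgla_br: "dgla sc Lg br d"
  unfolding dgla_def lin_on_def hom_map_def
proof (intro conjI allI impI ballI)
  show "graded_space sc Lg"
    using total_shift by (rule total_graded_space.graded)
  \<comment> \<open>Since \<open>2 * k - 1\<close> is odd, each exponent of the form degree plus one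
    has the parity of the shifted degree.\<close>
  fix m n x y z assume "x \<in> Lg m" and "y \<in> Lg n"
  then have x: "x \<in> G (m + (2 * k - 1))" and y: "y \<in> G (n + (2 * k - 1))"
    by (simp_all add: shift_def)
  show "br x y \<in> Lg (m + n)"
    using koszul2_l_degree[OF x y] by (simp add: br_koszul2[OF x] G_sgnp shift_def algebra_simps)
  show "br x y = - sgnp (m * n) (br y x)"
    unfolding br_anti[OF x y] by (cases "even m"; cases "even n") (simp_all add: sgnp_def)
  show "br x (br y z) = br (br x y) z + sgnp (m * n) (br y (br x z))"
    unfolding br_jacobi[OF x y] by (simp add: sgnp_def)
next
  fix m x y assume "x \<in> Lg m"
  then have x: "x \<in> G (m + (2 * k - 1))" by (simp add: shift_def)
  show "d x \<in> Lg (m + 1)"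
    using endo_degree[OF endo_d x] by (simp add: shift_def algebra_simps)
  show "d (br x y) = br (d x) y + sgnp m (br x (d y))"
    unfolding d_br[OF x] by (simp add: sgnp_def)
qed (simp_all add: br_add_left br_add_right br_scale_left br_scale_right d_d
    endo_add[OF endo_d] endo_scale[OF endo_d])

lemma homotopy_abelian_br: "homotopy_abelian sc Lg br d"
proof -
  interpret S: total_graded_space sc Lg by (rule total_shift)
  interpret homotopically_trivial_bracket sc Lg br q d
  proof
    show "dgla sc Lg br d" by (rule dgla_br)
    fix m n x y z assume "x \<in> Lg m" and "y \<in> Lg n"
    then have x: "x \<in> G (m + (2 * k - 1))" and y: "y \<in> G (n + (2 * k - 1))"
      by (simp_all add: shift_def)
    show "q x y \<in> Lg (m + n - 1)"
      using koszul2_i_degree[OF x y] by (simp add: q_koszul2[OF x] G_sgnp shift_def algebra_simps)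
    show "q x y = - sgnp (m * n) (q y x)"
      unfolding q_anti[OF x y] by (cases "even m"; cases "even n") (simp_all add: sgnp_def)
    show "q x (br y z) + sgnp m (br x (q y z)) =
        q (br x y) z + br (q x y) z + sgnp (m * n) (q y (br x z) + sgnp n (br y (q x z)))"
      using q_br[OF x y, of z] by (cases "even m"; cases "even n") (simp_all add: sgnp_def)
  next
    fix m x y assume "x \<in> Lg m"
    then have x: "x \<in> G (m + (2 * k - 1))" by (simp add: shift_def)
    show "br x y = - (d (q x y) + q (d x) y + sgnp m (q x (d y)))"
      unfolding br_eq_boundary[OF x] by (simp add: sgnp_def)
  qed (rule q_add_left q_add_right q_scale_left q_scale_right)+
  show ?thesis by (rule homotopy_abelian)
qed

text \<open>The Poisson identity is the derivation property of the symbol of \<open>l\<close>, that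
  is, order two of \<open>l\<close>.\<close>

lemma gerstenhaber_br: "gerstenhaber sc G d br k"
  unfolding gerstenhaber_def
proof (intro conjI allI impI dgca dgla_br)
  fix m n a b c assume a: "a \<in> G m" and b: "b \<in> G n"
  have "deriv (1 - 2 * k + m) (koszul2 (1 - 2 * k) m l a)"
    using order2_l a by (simp add: order2_def)
  from deriv_mult[OF this b, of c]
  show "br a (b * c) = br a b * c + sgnp ((m - 2 * k + 1) * n) (b * br a c)"
    unfolding br_koszul2[OF a]
    by (cases "even m"; cases "even n") (simp_all add: sgnp_def algebra_simps)
qed

lemma BV_algebra_l:
  assumes "\<And>x. l (l x) = 0"
  shows "BV_algebra sc G d (1 - 2 * k) l"
  unfolding BV_algebra_def
proof (intro conjI allI assms dgca)
  show "quasi_BV sc G (1 - 2 * k) l"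
    using order2_l by (simp only: quasi_BV_iff_order2)
  show "gcomm 1 d (1 - 2 * k) l = (\<lambda>_. 0)"
    by (rule ext) (simp add: gcomm_def sgnp_def d_l)
qed simp

end

theorem theorem4p3:
  fixes sc :: "'k::field_char_0 \<Rightarrow> 'v::ring_1 \<Rightarrow> 'v"
    and G :: "int \<Rightarrow> 'v set" and d i :: "'v \<Rightarrow> 'v" and k :: int
  assumes A: "dgca sc G d"
    and i: "quasi_BV sc G (- 2 * k) i"
    and li: "quasi_BV sc G (1 - 4 * k) (gcomm (1 - 2 * k) (gcomm (- 2 * k) i 1 d) (- 2 * k) i)"
  shows "gerstenhaber sc G d (brl G (gcomm (- 2 * k) i 1 d)) k
       \<and> homotopy_abelian sc (shift G (2 * k - 1)) (brl G (gcomm (- 2 * k) i 1 d)) d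
       \<and> ((\<forall>x. gcomm (- 2 * k) i 1 d (gcomm (- 2 * k) i 1 d x) = 0)
            \<longrightarrow> BV_algebra sc G d (1 - 2 * k) (gcomm (- 2 * k) i 1 d))"
proof -
  have comm: "\<And>x y m n. x \<in> G m \<Longrightarrow> y \<in> G n \<Longrightarrow> x * y = sgnp (m * n) (y * x)"
    and scale: "\<And>c x y. sc c (x * y) = sc c x * y" "\<And>c x y. sc c (x * y) = x * sc c y"
    using A unfolding dgca_def by blast+
  interpret quasi_BV_dgca sc G d i k
  proof
    show "graded_space sc G" "gcarrier G = UNIV" "1 \<in> G 0"
      using A unfolding dgca_def by blast+
    show "x * y \<in> G (m + n)" if "x \<in> G m" "y \<in> G n" for x y m n
      using A that unfolding dgca_def by blast
  qed (fact comm scale[symmetric] A i li)+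
  show ?thesis
    using gerstenhaber_br homotopy_abelian_br BV_algebra_l unfolding l_def by blast
qed

end
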